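(* There is an absolute constant $c>0$ such that the following holds for every positive integer $d$. Let $\mathcal{C}_1,\dots,\mathcal{C}_{3d}$ be finite families of convex bodies in $\mathbb{R}^d$. Assume that for any indices $1\leq i_1<\dots<i_{2d}\leq 3d$ and any selection of sets $C_{i_k}\in\mathcal{C}_{i_k}$ ($1\leq k\leq 2d$), the intersection $\bigcap_{k=1}^{2d} C_{i_k}$ is of volume at least $1$. Then there exists $1\leq i\leq 3d$ such that $\mathrm{Vol}\left(\bigcap_{C\in\mathcal{C}_i} C\right)\geq c^{d^2}d^{-7d^2/2}$.
   Context: A convex body in $\mathbb{R}^d$ is a compact convex set with non-empty interior. $\mathrm{Vol}$ denotes $d$-dimensional volume (Lebesgue measure). An absolute constant does not depend on $d$ or on the families. *)

theory Defs
  imports "HOL-Analysis.Analysis"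
begin

text \<open>
  The dimension \<open>d\<close> is quantified inside the statement, below the absolute constant, so it
  cannot be a type parameter. The space of dimension \<open>d\<close> is therefore the set of extensional
  functions from \<open>{..<d}\<close> to the reals, with the product topology (which is the Euclidean one)
  and product Lebesgue measure. This set is the carrier of both the topology and the measure.
\<close>

definition R_space :: "nat \<Rightarrow> (nat \<Rightarrow> real) set" where
  "R_space d = PiE {..<d} (\<lambda>_. UNIV)"

definition R_top :: "nat \<Rightarrow> (nat \<Rightarrow> real) topology" where
  "R_top d = product_topology (\<lambda>_. euclideanreal) {..<d}"

text \<open>
  \<open>emeasure\<close> of this Borel measure is used for volume: convex bodies are compact, so all sets
  concerned are Borel, and the value on the whole space is infinite rather than a default zero.
\<close>

definition R_vol :: "nat \<Rightarrow> (nat \<Rightarrow> real) set \<Rightarrow> ennreal" where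
  "R_vol d A = emeasure (PiM {..<d} (\<lambda>_. lborel)) A"

lemma topspace_R_top: "topspace (R_top d) = R_space d"
  by (simp add: R_top_def R_space_def)

lemma space_R_vol: "space (PiM {..<d} (\<lambda>_. lborel :: real measure)) = R_space d"
  by (simp add: R_space_def space_PiM)

definition R_convex :: "nat \<Rightarrow> (nat \<Rightarrow> real) set \<Rightarrow> bool" where
  "R_convex d K \<longleftrightarrow>
     (\<forall>x\<in>K. \<forall>y\<in>K. \<forall>u\<ge>0. \<forall>v\<ge>0. u + v = 1 \<longrightarrow> (\<lambda>i\<in>{..<d}. u * x i + v * y i) \<in> K)"

definition convex_body :: "nat \<Rightarrow> (nat \<Rightarrow> real) set \<Rightarrow> bool" where
  "convex_body d K \<longleftrightarrow> compactin (R_top d) K \<and> R_convex d K \<and> R_top d interior_of K \<noteq> {}"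

text \<open>Intersecting with the whole space makes the empty family have intersection \<open>R_space d\<close>.\<close>

definition R_Inter :: "nat \<Rightarrow> (nat \<Rightarrow> real) set set \<Rightarrow> (nat \<Rightarrow> real) set" where
  "R_Inter d F = R_space d \<inter> \<Inter> F"

end

theory Submission
  imports Defs "HOL-Library.Function_Algebras" "Jordan_Normal_Form.Determinant"
begin

text \<open>
  The proof transplants Lovasz's extremal argument for the colorful Helly theorem to volumes.

  Among all choices of \<open>2d - 1\<close> colors and one body of each, cut the intersection by the cube
  \<open>[-t, t]\<^sup>d\<close> whose size \<open>t\<close> makes the volume exactly \<open>1\<close>, and fix a choice for which \<open>t\<close> is
  largest. Let \<open>Q\<close> be its cube and \<open>M\<close> the resulting body of volume \<open>1\<close>. There remain \<open>d + 1\<close>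
  colors. Choose one body from each of them; together with the \<open>2d - 1\<close> fixed bodies and \<open>Q\<close> they
  form \<open>3d + 1\<close> convex sets, and any \<open>2d\<close> of these meet in volume at least \<open>1\<close>: without \<open>Q\<close> this
  is the hypothesis, with \<open>Q\<close> it is the maximality of \<open>t\<close>. By a quantitative Helly theorem
  (\<open>quantitative_helly\<close>) all of them meet in a set \<open>X\<close> of volume at least \<open>(d\<^sup>2 + d)\<^sup>-\<^sup>d\<close>, and
  \<open>X \<subseteq> M\<close>. As \<open>X\<close> is a convex subset of \<open>M\<close> that is not too small, it contains a translate of a
  cross-polytope \<open>W\<close> that depends on \<open>M\<close> only (\<open>inscribed_frame\<close>, \<open>erosion_of_large_subset\<close>).
  So the sets of translation vectors that push \<open>W\<close> into the bodies of the remaining colors satisfy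
  the hypothesis of the ordinary colorful Helly theorem (\<open>colorful_helly\<close>), and for one color a
  single translate of \<open>W\<close> lies in all bodies of the family. Since \<open>W\<close> contains a homothet of \<open>M\<close>
  with ratio of order \<open>c\<^sup>d d\<^sup>-\<^sup>3\<^sup>d\<close>, the volume is at least \<open>c ^ d\<^sup>2 * d powr (- 3 d\<^sup>2)\<close>.

  The quantitative Helly theorem follows by polarity. Place the origin in \<open>X\<close>, the
  intersection of all sets, so that \<open>- X \<subseteq> d X\<close> (\<open>center_exists\<close>). From the polars choose vectors
  \<open>u\<^sub>1, \<dots>, u\<^sub>d\<close> of maximal determinant. Every polar vector then has coordinates in \<open>[-1, 1]\<close> with
  respect to them, so \<open>X\<close> contains the cross-polytope \<open>{x. \<Sum>\<bar>\<langle>x, u\<^sub>i\<rangle>\<bar> \<le> 1}\<close>. By the choice of origin,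
  \<open>- (\<Sum>u\<^sub>i) / d\<^sup>2\<close> is a convex combination of \<open>0\<close> and \<open>d\<close> further polar vectors. The at most \<open>2d\<close> sets
  whose polars contain these \<open>2d\<close> vectors meet inside a simplex that is a homothet, with ratio \<open>d\<^sup>2 + d\<close>,
  of a part of that cross-polytope.

  All volume estimates use only translations, homotheties and the fact that the part of a convex
  set lost under a small translation is small (\<open>shift_loss\<close>).
\<close>

section \<open>The space of zero-extended coordinate vectors\<close>

instantiation "fun" :: (type, real_vector) real_vector
begin
definition scaleR_fun :: "real \<Rightarrow> ('a \<Rightarrow> 'b) \<Rightarrow> 'a \<Rightarrow> 'b" where
  "scaleR_fun r f = (\<lambda>x. r *\<^sub>R f x)"
instance
  by standard (auto simp: scaleR_fun_def fun_eq_iff algebra_simps)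
end

lemma scaleR_fun_apply [simp]: "(r *\<^sub>R f) x = r *\<^sub>R f x"
  by (simp add: scaleR_fun_def)

lemma sum_fun_apply: "(\<Sum>j\<in>J. f j) x = (\<Sum>j\<in>J. f j x)"
  by (induction J rule: infinite_finite_induct) auto

text \<open>
  Extension by zero instead of by \<open>undefined\<close> makes the space of dimension \<open>d\<close> a linear subspace
  of the real vector space \<open>nat \<Rightarrow> real\<close>. Convexity, span and independence then have their usual
  meaning although \<open>d\<close> is a variable.
\<close>
definition E :: "nat \<Rightarrow> (nat \<Rightarrow> real) set" where
  "E d = {x. \<forall>i\<ge>d. x i = 0}"

definition ip :: "nat \<Rightarrow> (nat \<Rightarrow> real) \<Rightarrow> (nat \<Rightarrow> real) \<Rightarrow> real" where
  "ip d x y = (\<Sum>i<d. x i * y i)"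

definition ax :: "nat \<Rightarrow> nat \<Rightarrow> real" where
  "ax i = (\<lambda>j. if j = i then 1 else 0)"

lemma subspace_E: "subspace (E d)"
  by (auto simp: E_def subspace_def)

lemma E_zero [simp]: "0 \<in> E d" and
  E_add: "x \<in> E d \<Longrightarrow> y \<in> E d \<Longrightarrow> x + y \<in> E d" and
  E_diff: "x \<in> E d \<Longrightarrow> y \<in> E d \<Longrightarrow> x - y \<in> E d" and
  E_minus: "x \<in> E d \<Longrightarrow> - x \<in> E d" and
  E_scale: "x \<in> E d \<Longrightarrow> r *\<^sub>R x \<in> E d"
  by (auto simp: E_def)

lemma E_sum: "(\<And>j. j \<in> J \<Longrightarrow> f j \<in> E d) \<Longrightarrow> (\<Sum>j\<in>J. f j) \<in> E d"
  by (auto simp: E_def sum_fun_apply)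

lemma convex_E: "convex (E d)"
  by (rule subspace_imp_convex[OF subspace_E])

lemma ax_in_E: "i < d \<Longrightarrow> ax i \<in> E d"
  by (auto simp: ax_def E_def)

lemma E_eqI: "x \<in> E d \<Longrightarrow> y \<in> E d \<Longrightarrow> (\<And>i. i < d \<Longrightarrow> x i = y i) \<Longrightarrow> x = y"
  by (auto simp: E_def fun_eq_iff) (metis not_le)

lemma E_expand:
  assumes "x \<in> E d" shows "x = (\<Sum>i<d. x i *\<^sub>R ax i)"
proof (rule E_eqI[OF assms])
  show "(\<Sum>i<d. x i *\<^sub>R ax i) \<in> E d" by (intro E_sum E_scale ax_in_E) auto
  fix i assume "i < d"
  then show "x i = (\<Sum>i<d. x i *\<^sub>R ax i) i"
    by (simp add: sum_fun_apply ax_def if_distrib cong: if_cong)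
qed

lemma ip_commute: "ip d x y = ip d y x" by (simp add: ip_def mult.commute)
lemma ip_add_left: "ip d (x + y) z = ip d x z + ip d y z" 
  and ip_diff_left: "ip d (x - y) z = ip d x z - ip d y z" 
  and ip_minus_left: "ip d (- x) z = - ip d x z" 
  and ip_scale_left: "ip d (r *\<^sub>R x) z = r * ip d x z" 
  by (auto simp: ip_def algebra_simps sum.distrib sum_subtractf sum_distrib_left sum_negf)
lemma ip_add_right: "ip d z (x + y) = ip d z x + ip d z y" 
  and ip_diff_right: "ip d z (x - y) = ip d z x - ip d z y" 
  and ip_minus_right: "ip d z (- x) = - ip d z x" 
  and ip_scale_right: "ip d z (r *\<^sub>R x) = r * ip d z x" 
  by (auto simp: ip_def algebra_simps sum.distrib sum_subtractf sum_distrib_left sum_negf)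
lemma ip_zero [simp]: "ip d 0 x = 0" "ip d x 0 = 0"
  by (auto simp: ip_def)
lemma ip_sum_right: "ip d z (\<Sum>j\<in>J. f j) = (\<Sum>j\<in>J. ip d z (f j))"
  by (simp add: ip_def sum_fun_apply sum_distrib_left) (rule sum.swap)
lemma ip_sum_left: "ip d (\<Sum>j\<in>J. f j) z = (\<Sum>j\<in>J. ip d (f j) z)"
  by (simp add: ip_def sum_fun_apply sum_distrib_right) (rule sum.swap)
lemmas ip_simps = ip_add_left ip_diff_left ip_minus_left ip_scale_left
  ip_add_right ip_diff_right ip_minus_right ip_scale_right ip_sum_left ip_sum_right

lemma ip_self_nonneg: "ip d x x \<ge> 0"
  by (auto simp: ip_def intro!: sum_nonneg)

lemma ip_self_eq_0:
  assumes "x \<in> E d" shows "ip d x x = 0 \<longleftrightarrow> x = 0"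
proof
  assume "ip d x x = 0"
  then have "\<forall>i\<in>{..<d}. x i * x i = 0"
    unfolding ip_def by (subst (asm) sum_nonneg_eq_0_iff) auto
  then show "x = 0" using assms by (intro E_eqI[of _ d]) auto
qed simp

lemma ip_ax: "i < d \<Longrightarrow> ip d x (ax i) = x i"
  by (simp add: ip_def ax_def if_distrib cong: if_cong)

lemma continuous_on_ip [continuous_intros]:
  assumes "continuous_on S f" "continuous_on S g"
  shows "continuous_on S (\<lambda>x. ip d (f x) (g x))"
  unfolding ip_def using assms
  by (intro continuous_intros) (auto intro: continuous_on_product_then_coordinatewise)

lemma continuous_on_add_fun:
  fixes f g :: "'a::topological_space \<Rightarrow> nat \<Rightarrow> real"
  assumes "continuous_on S f" "continuous_on S g"
  shows "continuous_on S (\<lambda>x. f x + g x)"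
  by (rule continuous_on_coordinatewise_then_product)
     (auto intro!: continuous_intros continuous_on_product_then_coordinatewise[OF assms(1)]
       continuous_on_product_then_coordinatewise[OF assms(2)])

lemma continuous_on_scale_fun:
  fixes f :: "'a::topological_space \<Rightarrow> nat \<Rightarrow> real"
  assumes "continuous_on S r" "continuous_on S f"
  shows "continuous_on S (\<lambda>x. r x *\<^sub>R f x)"
  by (rule continuous_on_coordinatewise_then_product)
     (auto intro!: continuous_intros assms(1) continuous_on_product_then_coordinatewise[OF assms(2)])

lemma continuous_on_sum_fun:
  fixes f :: "'b \<Rightarrow> 'a::topological_space \<Rightarrow> nat \<Rightarrow> real"
  assumes "\<And>j. j \<in> J \<Longrightarrow> continuous_on S (f j)"
  shows "continuous_on S (\<lambda>x. \<Sum>j\<in>J. f j x)"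
  by (rule continuous_on_coordinatewise_then_product)
     (auto intro!: continuous_intros continuous_on_product_then_coordinatewise[OF assms] simp: sum_fun_apply)

lemma continuous_on_diff_fun:
  fixes f g :: "'a::topological_space \<Rightarrow> nat \<Rightarrow> real"
  assumes "continuous_on S f" "continuous_on S g"
  shows "continuous_on S (\<lambda>x. f x - g x)"
  by (rule continuous_on_coordinatewise_then_product)
     (auto intro!: continuous_intros continuous_on_product_then_coordinatewise[OF assms(1)]
       continuous_on_product_then_coordinatewise[OF assms(2)])

lemma compact_PiE_UNIV:
  fixes S :: "'i \<Rightarrow> ('a::topological_space) set"
  assumes "\<And>i. compact (S i)"
  shows "compact (PiE UNIV S)"
  using compactin_PiE[of "\<lambda>_. euclidean" UNIV S] assms
  by (simp add: euclidean_product_topology)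

lemma closed_E: "closed (E d)"
proof -
  have "E d = (\<Inter>i\<in>{d..}. {x. x i = 0})" by (auto simp: E_def)
  then show ?thesis
    by (auto intro!: closed_INT closed_Collect_eq continuous_intros continuous_on_product_coordinates)
qed

section \<open>Helly's theorem and its colorful version\<close>

text \<open>
  The vectors are indexed, so that repetitions count: two equal vectors already give a dependency.
  Otherwise an independent set is no larger than the set of axis vectors, which spans.
\<close>
lemma E_dependency:
  assumes "finite J" "card J > d" "\<And>j. j \<in> J \<Longrightarrow> v j \<in> E d"
  shows "\<exists>c. (\<exists>j\<in>J. c j \<noteq> 0) \<and> (\<Sum>j\<in>J. c j *\<^sub>R v j) = 0"
proof (cases "inj_on v J")
  case False
  then obtain i j where ij: "i \<in> J" "j \<in> J" "i \<noteq> j" "v i = v j" by (auto simp: inj_on_def)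
  define c where "c k = (if k = i then 1 else if k = j then -1 else (0::real))" for k
  have "(\<Sum>k\<in>J. c k *\<^sub>R v k) = (\<Sum>k\<in>{i,j}. c k *\<^sub>R v k)"
    by (rule sum.mono_neutral_right) (use assms ij in \<open>auto simp: c_def\<close>)
  also have "\<dots> = 0" using ij by (simp add: c_def)
  finally show ?thesis using ij by (intro exI[of _ c]) (auto simp: c_def)
next
  case True
  have sp: "v ` J \<subseteq> span (ax ` {..<d})"
  proof
    fix x assume "x \<in> v ` J"
    then have "x \<in> E d" using assms by auto
    then show "x \<in> span (ax ` {..<d})"
      by (subst E_expand, assumption) (auto intro!: span_sum span_scale intro: span_base)
  qed
  have "dependent (v ` J)"
  proof (rule ccontr)
    assume "independent (v ` J)"
    from independent_span_bound[OF _ this sp] have "card (v ` J) \<le> card (ax ` {..<d})" by simp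
    also have "\<dots> \<le> d" using card_image_le[of "{..<d}" ax] by simp
    finally show False using assms card_image[OF True] by simp
  qed
  then obtain c where c: "\<exists>x\<in>v ` J. c x \<noteq> 0" "(\<Sum>x\<in>v ` J. c x *\<^sub>R x) = 0"
    using dependent_finite[of "v ` J"] assms(1) by auto
  show ?thesis using c True by (intro exI[of _ "c \<circ> v"]) (auto simp: sum.reindex)
qed

text \<open>
  Lift the points to height \<open>1\<close> along the axis of index \<open>d\<close>, which is orthogonal to \<open>E d\<close>; the last
  coordinate of a linear dependency then says that its coefficients add up to \<open>0\<close>.
\<close>
lemma radon_dependency:
  assumes "finite J" "card J \<ge> d + 2" "\<And>j. j \<in> J \<Longrightarrow> v j \<in> E d"
  shows "\<exists>c. (\<exists>j\<in>J. c j \<noteq> 0) \<and> sum c J = 0 \<and> (\<Sum>j\<in>J. c j *\<^sub>R v j) = 0"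
proof -
  have "\<exists>c. (\<exists>j\<in>J. c j \<noteq> 0) \<and> (\<Sum>j\<in>J. c j *\<^sub>R (v j + ax d)) = 0"
    by (rule E_dependency[where d = "Suc d"]) (use assms in \<open>auto simp: E_def ax_def\<close>)
  then obtain c where c: "\<exists>j\<in>J. c j \<noteq> 0" "(\<Sum>j\<in>J. c j *\<^sub>R (v j + ax d)) = 0" by auto
  have "(\<Sum>j\<in>J. c j *\<^sub>R (v j + ax d)) d = sum c J"
    using assms(3) by (auto simp: ax_def E_def sum_fun_apply intro!: sum.cong)
  then have s: "sum c J = 0" using c by simp
  have "(\<Sum>j\<in>J. c j *\<^sub>R (v j + ax d)) = (\<Sum>j\<in>J. c j *\<^sub>R v j) + sum c J *\<^sub>R ax d"
    by (simp add: scaleR_add_right sum.distrib scaleR_left.sum)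
  then show ?thesis using c s by auto
qed

text \<open>
  Radon's proof. Choose for each index \<open>j\<close> a point \<open>x j\<close> that lies in all sets but possibly \<open>A j\<close>.
  An affine dependency of these points splits the indices into two classes, and the convex hulls of the
  two classes share a point. Each \<open>A j\<close> contains the points of the class to which \<open>j\<close> does not belong,
  hence the shared point. The family is indexed, so that sets may be repeated.
\<close>
theorem helly:
  assumes "finite J" "J \<noteq> {}"
    and cvx: "\<And>j. j \<in> J \<Longrightarrow> convex (A j) \<and> A j \<subseteq> E d"
    and meet: "\<And>I. I \<subseteq> J \<Longrightarrow> I \<noteq> {} \<Longrightarrow> card I \<le> d + 1 \<Longrightarrow> (\<Inter>j\<in>I. A j) \<noteq> {}"
  shows "(\<Inter>j\<in>J. A j) \<noteq> {}"
  using assms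
proof (induction "card J" arbitrary: J rule: less_induct)
  case less
  show ?case
  proof (cases "card J \<le> d + 1")
    case True
    then show ?thesis using less.prems by blast
  next
    case False
    have "\<exists>x. x \<in> (\<Inter>i\<in>J - {j}. A i)" if "j \<in> J" for j
    proof -
      have "(\<Inter>i\<in>J - {j}. A i) \<noteq> {}"
      proof (rule less.hyps)
        show "card (J - {j}) < card J" using that less.prems(1) by (meson card_Diff1_less)
        have "card (J - {j}) \<noteq> 0" using False that less.prems(1) by (simp add: card_Diff_singleton)
        then show "J - {j} \<noteq> {}" by (metis card.empty)
        show "(\<Inter>i\<in>I. A i) \<noteq> {}" if "I \<subseteq> J - {j}" "I \<noteq> {}" "card I \<le> d + 1" for I
          using less.prems(4)[of I] that by blast
      qed (use less.prems in \<open>auto\<close>)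
      then show ?thesis by auto
    qed
    then obtain x where x: "\<And>i j. j \<in> J \<Longrightarrow> i \<in> J \<Longrightarrow> i \<noteq> j \<Longrightarrow> x j \<in> A i"
      by (metis (no_types, opaque_lifting) DiffI INT_E empty_iff insert_iff)
    have xE: "x j \<in> E d" if j: "j \<in> J" for j
    proof -
      have "\<exists>i\<in>J. i \<noteq> j" using False j less.prems(1)
        by (metis One_nat_def add.commute card_1_singleton_iff le_add1 plus_1_eq_Suc
              is_singletonI' is_singleton_def empty_iff)
      then show ?thesis using x[OF j] less.prems(3) by blast
    qed
    have "card J \<ge> d + 2" using False by simp
    from radon_dependency[where v = x, OF less.prems(1) this xE]
    obtain c where c: "\<exists>j\<in>J. c j \<noteq> 0" "sum c J = 0" "(\<Sum>j\<in>J. c j *\<^sub>R x j) = 0"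
      by blast
    define P where "P = {j\<in>J. c j > 0}"
    define s where "s = sum c P"
    have fin: "finite P" using less.prems(1) by (simp add: P_def)
    have JP: "sum g J = sum g P + sum g (J - P)" for g :: "_ \<Rightarrow> 'b::comm_monoid_add"
      using sum.subset_diff[of P J g] less.prems(1) by (auto simp: P_def add.commute)
    have s': "sum c (J - P) = - s" using JP[of c] c(2) by (simp add: s_def)
    have "s > 0"
    proof -
      have "s \<ge> 0" unfolding s_def by (rule sum_nonneg) (auto simp: P_def)
      moreover have "s \<noteq> 0"
      proof
        assume s0: "s = 0"
        then have "\<forall>j\<in>P. c j = 0" 
          using fin unfolding s_def by (subst (asm) sum_nonneg_eq_0_iff) (auto simp: P_def)
        moreover have "\<forall>j\<in>J-P. - c j = 0"
        proof -
          have "sum (\<lambda>j. - c j) (J - P) = 0" using s' s0 by (simp add: sum_negf)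
          moreover have "\<And>j. j \<in> J - P \<Longrightarrow> 0 \<le> - c j" by (auto simp: P_def)
          ultimately show ?thesis
            using sum_nonneg_eq_0_iff[of "J - P" "\<lambda>j. - c j"] less.prems(1) by blast
        qed
        ultimately show False using c(1) by (metis DiffI neg_equal_0_iff_equal)
      qed
      ultimately show ?thesis by simp
    qed
    define p where "p = (\<Sum>j\<in>P. (c j / s) *\<^sub>R x j)"
    have p2: "p = (\<Sum>j\<in>J - P. (- c j / s) *\<^sub>R x j)"
    proof -
      have "p = (1 / s) *\<^sub>R (\<Sum>j\<in>P. c j *\<^sub>R x j)"
        by (simp add: p_def scaleR_right.sum)
      also have "(\<Sum>j\<in>P. c j *\<^sub>R x j) = - (\<Sum>j\<in>J - P. c j *\<^sub>R x j)"
        using JP[of "\<lambda>j. c j *\<^sub>R x j"] c(3) by (simp add: eq_neg_iff_add_eq_0)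
      finally show ?thesis
        by (simp add: fun_eq_iff sum_fun_apply sum_negf flip: sum_divide_distrib)
    qed
    have "p \<in> A j" if j: "j \<in> J" for j
    proof (cases "j \<in> P")
      case True
      show ?thesis unfolding p2
      proof (rule convex_sum)
        show "sum (\<lambda>j. - c j / s) (J - P) = 1"
          using s' \<open>s > 0\<close> by (simp add: sum_negf flip: sum_divide_distrib)
        show "x i \<in> A j" if "i \<in> J - P" for i using x[of i j] that j True by auto
      qed (use less.prems j \<open>s > 0\<close> in \<open>auto simp: P_def divide_nonpos_pos\<close>)
    next
      case False
      show ?thesis unfolding p_def
      proof (rule convex_sum)
        show "sum (\<lambda>j. c j / s) P = 1"
          using \<open>s > 0\<close> by (simp add: s_def flip: sum_divide_distrib)
        show "x i \<in> A j" if "i \<in> P" for i using x[of i j] that j False by (auto simp: P_def)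
      qed (use less.prems j \<open>s > 0\<close> fin in \<open>auto simp: P_def\<close>)
    qed
    then show ?thesis by blast
  qed
qed

text \<open>
  The parallelogram law: the squared norm is strictly convex, which makes the point of least norm in a
  convex set unique.
\<close>
lemma sq_midpoint:
  assumes "x \<in> E d" "y \<in> E d" "ip d x x \<le> r" "ip d y y \<le> r" "x \<noteq> y"
  shows "ip d ((1/2) *\<^sub>R x + (1/2) *\<^sub>R y) ((1/2) *\<^sub>R x + (1/2) *\<^sub>R y) < r"
proof -
  define m where "m = (1/2) *\<^sub>R x + (1/2) *\<^sub>R y"
  have eq: "ip d m m = (ip d x x + ip d y y) / 2 - ip d (x - y) (x - y) / 4"
    unfolding m_def ip_simps ip_commute[of d y x] by (simp add: field_simps)
  have pos: "ip d (x - y) (x - y) > 0"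
    using ip_self_nonneg[of d "x - y"] ip_self_eq_0[OF E_diff[OF assms(1,2)]] assms(5) by simp
  have "(a + b) / 2 - c / 4 < r" if "a \<le> r" "b \<le> r" "c > 0" for a b c :: real
    using that by (simp add: field_simps)
  from this[OF assms(3,4) pos] show ?thesis unfolding m_def[symmetric] eq .
qed

lemma convex_sq_ball: "convex {x \<in> E d. ip d x x \<le> r}"
proof (rule convexI)
  fix x y and u v :: real
  assume *: "x \<in> {x \<in> E d. ip d x x \<le> r}" "y \<in> {x \<in> E d. ip d x x \<le> r}" "0 \<le> u" "0 \<le> v" "u + v = 1"
  have "ip d (u *\<^sub>R x + v *\<^sub>R y) (u *\<^sub>R x + v *\<^sub>R y)
      = (u + v) * (u * ip d x x + v * ip d y y) - u * v * ip d (x - y) (x - y)"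
    by (simp add: ip_simps ip_commute[of d y x] algebra_simps)
  also have "\<dots> \<le> u * ip d x x + v * ip d y y" using * by (simp add: ip_self_nonneg)
  also have "\<dots> \<le> u * r + v * r" using * by (intro add_mono mult_left_mono) auto
  also have "\<dots> = r" using * by (simp flip: distrib_right)
  finally show "u *\<^sub>R x + v *\<^sub>R y \<in> {x \<in> E d. ip d x x \<le> r}"
    using * by (auto intro!: E_add E_scale)
qed

definition convex_compact :: "nat \<Rightarrow> (nat \<Rightarrow> real) set \<Rightarrow> bool" where
  "convex_compact d K \<longleftrightarrow> convex K \<and> compact K \<and> K \<subseteq> E d"

lemma convex_compact_INT:
  assumes "J \<noteq> {}" "\<And>j. j \<in> J \<Longrightarrow> convex_compact d (A j)"
  shows "convex_compact d (\<Inter>j\<in>J. A j)"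
proof -
  obtain j where j: "j \<in> J" using assms by auto
  have "closed (\<Inter>j\<in>J. A j)"
    using assms by (intro closed_INT) (auto simp: convex_compact_def intro: compact_imp_closed)
  then have "compact (A j \<inter> (\<Inter>j\<in>J. A j))"
    by (rule compact_Int_closed[rotated]) (use j assms in \<open>simp add: convex_compact_def\<close>)
  also have "A j \<inter> (\<Inter>j\<in>J. A j) = (\<Inter>j\<in>J. A j)" using j by auto
  finally show ?thesis using assms j unfolding convex_compact_def
    by (auto intro!: convex_INT)
qed

lemma convex_compact_Int:
  assumes "convex_compact d A" "convex_compact d B" shows "convex_compact d (A \<inter> B)"
  using assms by (auto simp: convex_compact_def intro: convex_Int compact_Int)

lemma sq_min_exists:
  assumes "convex_compact d K" "K \<noteq> {}"
  shows "\<exists>p\<in>K. \<forall>x\<in>K. ip d p p \<le> ip d x x"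
proof -
  have "continuous_on K (\<lambda>x. ip d x x)" by (intro continuous_intros)
  then show ?thesis
    using continuous_attains_inf[of K "\<lambda>x. ip d x x"] assms by (auto simp: convex_compact_def)
qed

text \<open>
  The normal is \<open>u = x - q\<close> for the point \<open>q\<close> of \<open>C\<close> nearest to \<open>x\<close>: if the functional were larger at
  some \<open>y\<close> in \<open>C\<close> than at \<open>q\<close>, a step from \<open>q\<close> towards \<open>y\<close> would come closer to \<open>x\<close>.
\<close>
lemma separation:
  assumes C: "convex_compact d C" "C \<noteq> {}" and x: "x \<in> E d" "x \<notin> C"
  shows "\<exists>u\<in>E d. \<exists>b. (\<forall>y\<in>C. ip d u y \<le> b) \<and> b < ip d u x"
proof -
  have "continuous_on C (\<lambda>y. ip d (x - y) (x - y))"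
    by (intro continuous_intros continuous_on_diff_fun)
  then obtain q where q: "q \<in> C" "\<And>y. y \<in> C \<Longrightarrow> ip d (x - q) (x - q) \<le> ip d (x - y) (x - y)"
    using continuous_attains_inf[of C "\<lambda>y. ip d (x - y) (x - y)"] C
    by (auto simp: convex_compact_def)
  have qE: "q \<in> E d" using q C by (auto simp: convex_compact_def)
  define u where "u = x - q"
  have uE: "u \<in> E d" using x qE by (simp add: u_def E_diff)
  have "ip d u y \<le> ip d u q" if y: "y \<in> C" for y
  proof (rule ccontr)
    assume "\<not> ip d u y \<le> ip d u q"
    then have a: "ip d u (y - q) > 0" by (simp add: ip_simps)
    define a where "a = ip d u (y - q)"
    define b where "b = ip d (y - q) (y - q)"
    have b: "b \<ge> 0" by (simp add: b_def ip_self_nonneg)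
    \<comment> \<open>On the segment from \<open>q\<close> to \<open>y\<close> the squared distance to \<open>x\<close> changes by \<open>t\<^sup>2 * b - 2 * t * a\<close>, which is negative for this \<open>t\<close>.\<close>
    define t where "t = a / (a + b)"
    have t: "0 < t" "t \<le> 1" using a b by (auto simp: t_def a_def)
    have "(1 - t) *\<^sub>R q + t *\<^sub>R y \<in> C"
      using C q y t by (intro convexD) (auto simp: convex_compact_def)
    from q(2)[OF this] have "ip d u u \<le> ip d (x - ((1 - t) *\<^sub>R q + t *\<^sub>R y)) (x - ((1 - t) *\<^sub>R q + t *\<^sub>R y))"
      by (simp add: u_def)
    also have "x - ((1 - t) *\<^sub>R q + t *\<^sub>R y) = u - t *\<^sub>R (y - q)"
      by (simp add: u_def algebra_simps)
    also have "ip d (u - t *\<^sub>R (y - q)) (u - t *\<^sub>R (y - q)) = ip d u u - 2 * t * a + t\<^sup>2 * b"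
      unfolding a_def b_def ip_simps ip_commute[of d y u] ip_commute[of d q u] ip_commute[of d q y]
      by (simp add: algebra_simps power2_eq_square)
    finally have "2 * a \<le> t * b" using t by (simp add: power2_eq_square)
    also have "t * b \<le> a" using a b by (simp add: t_def a_def divide_simps mult_left_mono)
    finally show False using a by (simp add: a_def)
  qed
  moreover have "ip d u q < ip d u x"
  proof -
    have "ip d u u > 0" using ip_self_nonneg[of d u] ip_self_eq_0[OF uE] x q(1) 
      by (auto simp: u_def less_le)
    then show ?thesis by (simp add: u_def ip_diff_right)
  qed
  ultimately show ?thesis using uE by blast
qed

text \<open>
  Lovasz's extremal argument. For each choice of \<open>d\<close> colors and one set of each, consider the point of
  the intersection nearest to \<open>0\<close>, and take a choice for which its norm is largest; let \<open>p\<close> be that point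
  and \<open>i\<close> the color left out. For \<open>C\<close> in \<open>\<F> i\<close>, consider the \<open>d\<close> chosen sets, \<open>C\<close>, and the ball around
  \<open>0\<close> through \<open>p\<close>. Any \<open>d + 1\<close> of these \<open>d + 2\<close> sets meet: without the ball by hypothesis, with it by
  the maximality. By Helly's theorem all of them meet, and the chosen sets meet the ball only in \<open>p\<close>, so
  \<open>p\<close> is in \<open>C\<close>.
\<close>
theorem colorful_helly:
  fixes \<F> :: "'i \<Rightarrow> (nat \<Rightarrow> real) set set"
  assumes R: "finite R" "card R = d + 1" and "d \<ge> 1"
    and fam: "\<And>i. i \<in> R \<Longrightarrow> finite (\<F> i) \<and> \<F> i \<noteq> {}"
    and cc: "\<And>i C. i \<in> R \<Longrightarrow> C \<in> \<F> i \<Longrightarrow> convex_compact d C"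
    and rainbow: "\<And>g. (\<And>i. i \<in> R \<Longrightarrow> g i \<in> \<F> i) \<Longrightarrow> (\<Inter>i\<in>R. g i) \<noteq> {}"
  shows "\<exists>i\<in>R. \<Inter>(\<F> i) \<noteq> {}"
proof -
  define Sel where "Sel = (SIGMA i:R. PiE (R - {i}) \<F>)"
  define P where "P s = (\<Inter>k\<in>R - {fst s}. snd s k)" for s :: "'i \<times> ('i \<Rightarrow> (nat \<Rightarrow> real) set)"
  define v where "v s = Inf ((\<lambda>x. ip d x x) ` P s)" for s
  have finSel: "finite Sel" unfolding Sel_def using R fam by (intro finite_SigmaI finite_PiE) auto
  have neSel: "Sel \<noteq> {}"
    unfolding Sel_def using R fam by (auto simp: Sigma_empty_iff PiE_eq_empty_iff)
  have ne: "R - {i} \<noteq> {}" for i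
  proof
    assume "R - {i} = {}"
    then have "card R \<le> card {i}" by (intro card_mono) auto
    then show False using R \<open>d \<ge> 1\<close> by simp
  qed
  have ccP: "convex_compact d (P s)" if "s \<in> Sel" for s
    unfolding P_def using that ne cc by (intro convex_compact_INT) (auto simp: Sel_def PiE_iff)
  have neP: "P s \<noteq> {}" if s: "s \<in> Sel" for s
  proof -
    obtain i g where s: "s = (i, g)" "i \<in> R" "g \<in> PiE (R - {i}) \<F>" using s by (auto simp: Sel_def)
    obtain C where "C \<in> \<F> i" using fam[OF s(2)] by auto
    then have "(\<Inter>k\<in>R. (g(i := C)) k) \<noteq> {}" using s by (intro rainbow) (auto simp: PiE_iff)
    then show ?thesis using s by (auto simp: P_def)
  qed
  have minP: "\<exists>p\<in>P s. ip d p p = v s \<and> (\<forall>x\<in>P s. v s \<le> ip d x x)" if sSel: "s \<in> Sel" for s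
  proof -
    obtain p where p: "p \<in> P s" "\<forall>x\<in>P s. ip d p p \<le> ip d x x"
      using sq_min_exists[OF ccP neP, OF sSel sSel] by blast
    then have "v s = ip d p p" unfolding v_def by (intro cInf_eq_minimum) auto
    then show ?thesis using p by auto
  qed
  obtain s where s: "s \<in> Sel" and max: "\<And>s'. s' \<in> Sel \<Longrightarrow> v s' \<le> v s"
  proof -
    have "Max (v ` Sel) \<in> v ` Sel" using finSel neSel by (intro Max_in) auto
    then obtain s where "s \<in> Sel" "v s = Max (v ` Sel)" by auto
    then show ?thesis using finSel by (intro that[of s]) auto
  qed
  obtain i f where if_s: "s = (i, f)" "i \<in> R" "f \<in> PiE (R - {i}) \<F>" using s by (auto simp: Sel_def)
  define B where "B = {x \<in> E d. ip d x x \<le> v s}"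
  obtain p where p: "p \<in> P s" "ip d p p = v s" "\<And>x. x \<in> P s \<Longrightarrow> v s \<le> ip d x x"
    using minP[OF s] by auto
  have pE: "p \<in> E d" using p ccP[OF s] by (auto simp: convex_compact_def)
  have "p \<in> C" if C: "C \<in> \<F> i" for C
  proof -
    define g where "g = f(i := C)"
    have g: "g k \<in> \<F> k" if "k \<in> R" for k using if_s C that by (auto simp: g_def PiE_iff)
    define A where "A = (\<lambda>k. case k of None \<Rightarrow> B | Some j \<Rightarrow> g j)"
    have "(\<Inter>k\<in>insert None (Some ` R). A k) \<noteq> {}"
    proof (rule helly[where d = d])
      fix k assume "k \<in> insert None (Some ` R)"
      then show "convex (A k) \<and> A k \<subseteq> E d"
        using cc[OF _ g] by (force simp: A_def B_def convex_sq_ball convex_compact_def)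
    next
      fix I assume I: "I \<subseteq> insert None (Some ` R)" "I \<noteq> {}" "card I \<le> d + 1"
      have "card (insert None (Some ` R)) = d + 2"
        using R by (subst card_insert_disjoint) (auto simp: card_image)
      then have "I \<noteq> insert None (Some ` R)" using I(3) by auto
      then consider "None \<notin> I" | k where "k \<in> R" "Some k \<notin> I" using I(1) by auto
      then show "(\<Inter>k\<in>I. A k) \<noteq> {}"
      proof cases
        case 1
        then have "(\<Inter>k\<in>R. g k) \<subseteq> (\<Inter>k\<in>I. A k)" using I by (auto simp: A_def)
        then show ?thesis using rainbow[of g] g by auto
      next
        case (2 k)
        define s' where "s' = (k, restrict g (R - {k}))"
        have s': "s' \<in> Sel" using 2 g by (auto simp: s'_def Sel_def)
        obtain q where q: "q \<in> P s'" "ip d q q = v s'" using minP[OF s'] by auto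
        have "q \<in> E d" using q ccP[OF s'] by (auto simp: convex_compact_def)
        then have "q \<in> B" using max[OF s'] q by (auto simp: B_def)
        moreover have "q \<in> g k'" if "k' \<in> R" "k' \<noteq> k" for k'
          using q(1) that by (auto simp: P_def s'_def)
        ultimately have "q \<in> (\<Inter>k\<in>I. A k)" using 2 I by (fastforce simp: A_def split: option.split)
        then show ?thesis by auto
      qed
    qed (use R in auto)
    then obtain q where "q \<in> (\<Inter>k\<in>insert None (Some ` R). A k)" by auto
    then have q: "q \<in> B" "\<And>k. k \<in> R \<Longrightarrow> q \<in> g k" by (auto simp: A_def)
    have qP: "q \<in> P s"
      unfolding P_def if_s fst_conv snd_conv
    proof (rule INT_I)
      fix k assume "k \<in> R - {i}"
      then show "q \<in> f k" using q(2)[of k] by (simp add: g_def)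
    qed
    have "q = p"
    proof (rule ccontr)
      assume "q \<noteq> p"
      let ?m = "(1/2) *\<^sub>R q + (1/2) *\<^sub>R p"
      have "ip d ?m ?m < v s"
        using sq_midpoint[of q d p "v s"] q(1) pE p(2) \<open>q \<noteq> p\<close> by (auto simp: B_def)
      moreover have "?m \<in> P s"
        using ccP[OF s] p(1) qP by (intro convexD) (auto simp: convex_compact_def)
      ultimately show False using p(3) by fastforce
    qed
    then show ?thesis using q(2)[OF if_s(2)] by (simp add: g_def)
  qed
  then have "p \<in> \<Inter>(\<F> i)" by auto
  then show ?thesis using if_s(2) by blast
qed

section \<open>Volume\<close>

definition zext :: "nat \<Rightarrow> (nat \<Rightarrow> real) \<Rightarrow> nat \<Rightarrow> real" where
  "zext d x = (\<lambda>i. if i < d then x i else 0)"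

text \<open>
  Pushing the product measure forward along the zero extension gives a Borel measure on the whole type
  \<open>nat \<Rightarrow> real\<close>, concentrated on \<open>E d\<close>.
\<close>
definition mu :: "nat \<Rightarrow> (nat \<Rightarrow> real) measure" where
  "mu d = distr (PiM {..<d} (\<lambda>_. lborel)) borel (zext d)"

definition vol :: "nat \<Rightarrow> (nat \<Rightarrow> real) set \<Rightarrow> real" where
  "vol d A = measure (mu d) A"

lemma zext_in_E: "zext d x \<in> E d"
  by (simp add: zext_def E_def)

lemma measurable_zext [measurable]: "zext d \<in> measurable (PiM {..<d} (\<lambda>_. lborel)) borel"
proof (rule measurable_coordinatewise_then_product)
  fix i show "(\<lambda>x. zext d x i) \<in> borel_measurable (PiM {..<d} (\<lambda>_. lborel))"
    by (cases "i < d") (auto simp: zext_def)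
qed

lemma sets_mu [simp, measurable_cong]: "sets (mu d) = sets borel"
  by (simp add: mu_def)

lemma space_mu [simp]: "space (mu d) = UNIV"
  by (simp add: mu_def)

lemma emeasure_mu:
  "A \<in> sets borel \<Longrightarrow> emeasure (mu d) A =
     emeasure (PiM {..<d} (\<lambda>_. lborel)) (zext d -` A \<inter> space (PiM {..<d} (\<lambda>_. lborel)))"
  by (simp add: mu_def emeasure_distr)

text \<open>
  Homotheties act on each coordinate separately, so it suffices to compare the measures on boxes, where
  the one-dimensional scaling rule applies to each factor.
\<close>
lemma PiM_lborel_affine:
  fixes a :: "'i \<Rightarrow> real"
  assumes I: "finite I" and r: "r \<noteq> 0"
  defines "N \<equiv> PiM I (\<lambda>_. lborel :: real measure)"
  defines "T \<equiv> (\<lambda>x. \<lambda>i\<in>I. a i + r * x i)"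
  shows "density (distr N N T) (\<lambda>_. ennreal (\<bar>r\<bar> ^ card I)) = N"
  unfolding N_def
proof (rule product_sigma_finite.PiM_eqI)
  show "product_sigma_finite (\<lambda>_::'i. lborel :: real measure)"
    by (simp add: product_sigma_finite_def sigma_finite_lborel)
  interpret product_sigma_finite "\<lambda>_::'i. lborel :: real measure"
    by (simp add: product_sigma_finite_def sigma_finite_lborel)
  show "finite I" by fact
  have T [measurable]: "T \<in> measurable N N" unfolding T_def N_def by measurable
  show "sets (density (distr (PiM I (\<lambda>_. lborel)) (PiM I (\<lambda>_. lborel)) T)
      (\<lambda>_. ennreal (\<bar>r\<bar> ^ card I))) = sets (PiM I (\<lambda>_. lborel))"
    by simp
  fix A :: "'i \<Rightarrow> real set" assume A: "\<And>i. i \<in> I \<Longrightarrow> A i \<in> sets lborel"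
  define A' where "A' i = (\<lambda>x. a i + r * x) -` A i" for i
  have A': "A' i \<in> sets lborel" if "i \<in> I" for i
    using measurable_sets[of "\<lambda>x. a i + r * x" borel borel "A i"] A[OF that] by (simp add: A'_def)
  have AN: "PiE I A \<in> sets N" unfolding N_def using A I by (intro sets_PiM_I_finite) auto
  have one: "emeasure lborel (A i) = ennreal \<bar>r\<bar> * emeasure lborel (A' i)" if "i \<in> I" for i
    using A[OF that] by (subst lborel_real_affine[OF r, of "a i"])
      (simp add: emeasure_density emeasure_distr A'_def nn_integral_cmult nn_integral_distr)
  have "emeasure (density (distr N N T) (\<lambda>_. ennreal (\<bar>r\<bar> ^ card I))) (PiE I A)
      = ennreal (\<bar>r\<bar> ^ card I) * emeasure N (T -` PiE I A \<inter> space N)"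
    using AN by (simp add: emeasure_density_const emeasure_distr)
  also have "T -` PiE I A \<inter> space N = PiE I A'"
    by (auto simp: T_def N_def space_PiM A'_def PiE_iff extensional_def)
  also have "emeasure N (PiE I A') = (\<Prod>i\<in>I. emeasure lborel (A' i))"
    unfolding N_def using A' I by (intro emeasure_PiM) auto
  also have "ennreal (\<bar>r\<bar> ^ card I) * \<dots> = (\<Prod>i\<in>I. emeasure lborel (A i))"
    by (simp add: one prod.distrib flip: ennreal_power)
  finally show "emeasure (density (distr (PiM I (\<lambda>_. lborel)) (PiM I (\<lambda>_. lborel)) T)
      (\<lambda>_. ennreal (\<bar>r\<bar> ^ card I))) (PiE I A) = (\<Prod>i\<in>I. emeasure lborel (A i))"
    by (simp add: N_def)
qed

lemma affine_image_eq_vimage: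
  fixes a :: "nat \<Rightarrow> real"
  assumes "r \<noteq> 0"
  shows "(\<lambda>x. a + r *\<^sub>R x) ` A = (\<lambda>y. (1 / r) *\<^sub>R (y - a)) -` A"
proof -
  have "y \<in> (\<lambda>x. a + r *\<^sub>R x) ` A" if "(1 / r) *\<^sub>R (y - a) \<in> A" for y
    using assms that by (intro image_eqI[of _ _ "(1 / r) *\<^sub>R (y - a)"]) auto
  then show ?thesis using assms by auto
qed

lemma continuous_on_affine_fun:
  fixes a :: "nat \<Rightarrow> real" shows "continuous_on S (\<lambda>x. a + r *\<^sub>R x)"
  by (intro continuous_on_add_fun continuous_on_scale_fun continuous_intros)

lemma borel_affine_image:
  fixes a :: "nat \<Rightarrow> real"
  assumes "r \<noteq> 0" "A \<in> sets borel"
  shows "(\<lambda>x. a + r *\<^sub>R x) ` A \<in> sets borel"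
proof -
  have "continuous_on UNIV (\<lambda>y. (1 / r) *\<^sub>R (y - a))"
    by (intro continuous_on_diff_fun continuous_on_scale_fun continuous_intros)
  then have "(\<lambda>y. (1 / r) *\<^sub>R (y - a)) -` A \<inter> space borel \<in> sets borel"
    using assms(2) by (intro measurable_sets[where A = borel] borel_measurable_continuous_onI)
  then show ?thesis by (simp add: affine_image_eq_vimage[OF assms(1)])
qed

lemma emeasure_mu_affine:
  assumes r: "r \<noteq> 0" and a: "a \<in> E d" and A: "A \<in> sets borel"
  shows "emeasure (mu d) ((\<lambda>x. a + r *\<^sub>R x) ` A) = ennreal (\<bar>r\<bar> ^ d) * emeasure (mu d) A"
proof -
  define N where "N = PiM {..<d} (\<lambda>_. lborel :: real measure)"
  define T where "T = (\<lambda>x. \<lambda>i\<in>{..<d}. a i + r * x i)"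
  have N: "density (distr N N T) (\<lambda>_. ennreal (\<bar>r\<bar> ^ d)) = N"
    using PiM_lborel_affine[of "{..<d}" r a] r by (simp add: N_def T_def)
  have T [measurable]: "T \<in> measurable N N" unfolding T_def N_def by measurable
  have [measurable]: "zext d \<in> measurable N borel" by (simp add: N_def)
  let ?g = "\<lambda>x. a + r *\<^sub>R x"
  have gA: "?g ` A \<in> sets borel" using r A by (rule borel_affine_image)
  have eq: "T -` (zext d -` (?g ` A) \<inter> space N) \<inter> space N = zext d -` A \<inter> space N"
  proof -
    have "zext d (T x) = ?g (zext d x)" for x
      using a by (auto simp: zext_def T_def E_def fun_eq_iff)
    moreover have "?g y \<in> ?g ` A \<longleftrightarrow> y \<in> A" for y using r by auto
    ultimately show ?thesis using measurable_space[OF T] by (auto simp del: image_iff)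
  qed
  have "emeasure (mu d) (?g ` A) = emeasure N (zext d -` (?g ` A) \<inter> space N)"
    using gA by (simp add: emeasure_mu N_def)
  also have "\<dots> = emeasure (density (distr N N T) (\<lambda>_. ennreal (\<bar>r\<bar> ^ d))) (zext d -` (?g ` A) \<inter> space N)"
    by (simp add: N)
  also have "\<dots> = ennreal (\<bar>r\<bar> ^ d) * emeasure N (T -` (zext d -` (?g ` A) \<inter> space N) \<inter> space N)"
    using gA by (subst emeasure_density_const) (auto simp: emeasure_distr)
  also have "\<dots> = ennreal (\<bar>r\<bar> ^ d) * emeasure (mu d) A"
    unfolding eq using A by (simp add: emeasure_mu N_def)
  finally show ?thesis .
qed

lemma vol_affine:
  assumes "r \<noteq> 0" "a \<in> E d" "A \<in> sets borel"
  shows "vol d ((\<lambda>x. a + r *\<^sub>R x) ` A) = \<bar>r\<bar> ^ d * vol d A"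
  by (simp add: vol_def measure_def emeasure_mu_affine[OF assms] enn2real_mult)

lemma abs_le_interval: "\<bar>a\<bar> \<le> t \<longleftrightarrow> -t \<le> a \<and> a \<le> t" for a t :: real
  by linarith

definition cube :: "nat \<Rightarrow> real \<Rightarrow> (nat \<Rightarrow> real) set" where
  "cube d t = {x \<in> E d. \<forall>i<d. \<bar>x i\<bar> \<le> t}"

lemma convex_cube: "convex (cube d t)"
proof -
  have "cube d t = E d \<inter> (\<Inter>i\<in>{..<d}. {x. \<bar>x i\<bar> \<le> t})" by (auto simp: cube_def)
  moreover have "convex {x :: nat \<Rightarrow> real. \<bar>x i\<bar> \<le> t}" for i
  proof (rule convexI)
    fix x y :: "nat \<Rightarrow> real" and u v :: real
    assume *: "x \<in> {x. \<bar>x i\<bar> \<le> t}" "y \<in> {x. \<bar>x i\<bar> \<le> t}" "0 \<le> u" "0 \<le> v" "u + v = 1"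
    then have "\<bar>u * x i + v * y i\<bar> \<le> t"
      using convexD[OF convex_real_interval(5)[of "-t" t], of "x i" "y i" u v] by (auto simp: abs_le_interval)
    then show "u *\<^sub>R x + v *\<^sub>R y \<in> {x. \<bar>x i\<bar> \<le> t}" by simp
  qed
  ultimately show ?thesis by (auto intro!: convex_Int convex_INT convex_E)
qed

lemma compact_cube: "compact (cube d t)"
proof -
  have "x \<in> cube d t \<longleftrightarrow> x \<in> PiE UNIV (\<lambda>i. if i < d then {-t..t} else {0})" for x
    by (auto simp: cube_def E_def PiE_iff abs_le_interval not_less)
  then have "cube d t = PiE UNIV (\<lambda>i. if i < d then {-t..t} else {0})" by blast
  then show ?thesis by (auto intro!: compact_PiE_UNIV)
qed

lemma cube_subset_E: "cube d t \<subseteq> E d"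
  by (auto simp: cube_def)

lemma convex_compact_cube: "convex_compact d (cube d t)"
  by (simp add: convex_compact_def convex_cube compact_cube cube_subset_E)

lemma emeasure_cube:
  assumes "t \<ge> 0" shows "emeasure (mu d) (cube d t) = ennreal ((2 * t) ^ d)"
proof -
  interpret product_sigma_finite "\<lambda>_::nat. lborel :: real measure"
    by (simp add: product_sigma_finite_def sigma_finite_lborel)
  have "x \<in> zext d -` cube d t \<inter> space (PiM {..<d} (\<lambda>_. lborel :: real measure)) \<longleftrightarrow>
      x \<in> PiE {..<d} (\<lambda>_. {-t..t})" for x
    using zext_in_E[of d x]
    by (auto simp: cube_def space_PiM PiE_iff zext_def abs_le_interval)
  then have eq: "zext d -` cube d t \<inter> space (PiM {..<d} (\<lambda>_. lborel :: real measure))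
      = PiE {..<d} (\<lambda>_. {-t..t})" by blast
  have "emeasure (mu d) (cube d t) = emeasure (PiM {..<d} (\<lambda>_. lborel)) (PiE {..<d} (\<lambda>_. {-t..t}))"
    unfolding eq[symmetric] by (rule emeasure_mu) (simp add: borel_compact compact_cube)
  also have "\<dots> = (\<Prod>i<d. emeasure lborel {-t..t})" by (rule emeasure_PiM) auto
  also have "\<dots> = ennreal ((2 * t) ^ d)" using assms by (simp add: ennreal_power)
  finally show ?thesis .
qed

lemma vol_cube: "t \<ge> 0 \<Longrightarrow> vol d (cube d t) = (2 * t) ^ d"
  by (simp add: vol_def measure_def emeasure_cube)

lemma compact_subset_cube:
  assumes "compact K" "K \<subseteq> E d" shows "\<exists>t\<ge>0. K \<subseteq> cube d t"
proof -
  have "continuous_on K (\<lambda>x. \<Sum>i<d. \<bar>x i\<bar>)"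
    by (intro continuous_intros continuous_on_product_then_coordinatewise[OF continuous_on_id])
  then have "bounded ((\<lambda>x. \<Sum>i<d. \<bar>x i\<bar>) ` K)"
    using assms compact_continuous_image compact_imp_bounded by blast
  then obtain t where t: "\<And>x. x \<in> K \<Longrightarrow> \<bar>\<Sum>i<d. \<bar>x i\<bar>\<bar> \<le> t" by (auto simp: bounded_iff)
  have "K \<subseteq> cube d \<bar>t\<bar>"
  proof
    fix x assume x: "x \<in> K"
    have "\<bar>x i\<bar> \<le> \<bar>t\<bar>" if "i < d" for i
    proof -
      have "\<bar>x i\<bar> \<le> (\<Sum>i<d. \<bar>x i\<bar>)" using that by (intro member_le_sum) auto
      then show ?thesis using t[OF x] by linarith
    qed
    then show "x \<in> cube d \<bar>t\<bar>" using x assms by (auto simp: cube_def)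
  qed
  then show ?thesis by (intro exI[of _ "\<bar>t\<bar>"]) auto
qed

lemma emeasure_compact_finite:
  assumes "compact K" "K \<subseteq> E d" shows "emeasure (mu d) K < \<infinity>"
proof -
  obtain t where "t \<ge> 0" "K \<subseteq> cube d t" using compact_subset_cube[OF assms] by auto
  then have "emeasure (mu d) K \<le> ennreal ((2 * t) ^ d)"
    using emeasure_mono[of K "cube d t" "mu d"] by (simp add: emeasure_cube borel_compact compact_cube)
  then show ?thesis by (simp add: le_less_trans[OF _ ennreal_less_top])
qed

lemma emeasure_eq_vol:
  assumes "compact K" "K \<subseteq> E d" shows "emeasure (mu d) K = ennreal (vol d K)"
  using emeasure_compact_finite[OF assms] by (simp add: vol_def emeasure_eq_ennreal_measure)

lemma vol_mono:
  assumes "compact A" "A \<subseteq> B" "compact B" "B \<subseteq> E d" shows "vol d A \<le> vol d B"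
  unfolding vol_def using assms emeasure_compact_finite[of B d]
  by (intro measure_mono_fmeasurable) (auto simp: fmeasurable_def borel_compact)

lemma vol_nonneg: "vol d A \<ge> 0" by (simp add: vol_def)

lemma emeasure_E_infinite:
  assumes "d \<ge> 1" shows "emeasure (mu d) UNIV = \<infinity>"
proof -
  have "ennreal (real n) \<le> emeasure (mu d) UNIV" for n
  proof -
    have "real n \<le> (2 * real (Suc n)) ^ d"
    proof -
      have "real n \<le> (2 * real (Suc n)) ^ 1" by simp
      also have "\<dots> \<le> (2 * real (Suc n)) ^ d" using assms by (intro power_increasing) auto
      finally show ?thesis .
    qed
    then have "ennreal (real n) \<le> emeasure (mu d) (cube d (real (Suc n)))"
      by (subst emeasure_cube) (auto intro!: ennreal_leI)
    also have "\<dots> \<le> emeasure (mu d) UNIV" by (intro emeasure_mono) auto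
    finally show ?thesis .
  qed
  then show ?thesis by (metis ennreal_Ex_less_of_nat ennreal_of_nat_eq_real_of_nat infinity_ennreal_def less_top not_le)
qed

text \<open>
  The volume of the part of \<open>K\<close> in a growing cube grows no faster than the volume of the cube, so it is a
  continuous function of \<open>t\<close>, and the intermediate value theorem applies.
\<close>
lemma vol_cube_cut:
  assumes "compact K" "K \<subseteq> E d" "1 \<le> vol d K" "d \<ge> 1"
  shows "\<exists>t\<ge>0. vol d (K \<inter> cube d t) = 1"
proof -
  define f where "f t = vol d (K \<inter> cube d t)" for t
  obtain T where T: "T \<ge> 0" "K \<subseteq> cube d T" using compact_subset_cube[OF assms(1,2)] by auto
  have fm: "K \<inter> cube d t \<in> fmeasurable (mu d)" "cube d t \<in> fmeasurable (mu d)" for t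
    using emeasure_compact_finite[of "K \<inter> cube d t" d] emeasure_compact_finite[of "cube d t" d] assms(1)
    by (auto simp: fmeasurable_def borel_compact compact_Int compact_cube cube_subset_E le_infI2)
  have [simp]: "K \<in> sets borel" "cube d t \<in> sets borel" "K \<inter> cube d t \<in> sets borel" for t
    using assms(1) by (simp_all add: borel_compact compact_cube compact_Int sets.Int)
  have mono: "cube d s \<subseteq> cube d t" if "s \<le> t" for s t using that by (force simp: cube_def)
  have step: "f s \<le> f t \<and> f t - f s \<le> (2 * t) ^ d - (2 * s) ^ d" if "0 \<le> s" "s \<le> t" for s t
  proof
    show "f s \<le> f t" unfolding f_def vol_def
      using mono[OF that(2)] fm[of s] fm[of t]
      by (intro measure_mono_fmeasurable) (auto simp: fmeasurable_def simp del: sets_mu)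
    have "f t - f s = measure (mu d) (K \<inter> cube d t - K \<inter> cube d s)"
      unfolding f_def vol_def using mono[OF that(2)] fm
      by (subst measurable_measure_Diff) (auto dest: fmeasurableD)
    also have "\<dots> \<le> measure (mu d) (cube d t - cube d s)"
      using fm fmeasurable_Diff[OF fm(2), of "cube d s"]
      by (intro measure_mono_fmeasurable) (auto intro!: sets.Diff)
    also have "\<dots> = (2 * t) ^ d - (2 * s) ^ d"
      using mono[OF that(2)] fm vol_cube[of s d] vol_cube[of t d] that
      by (subst measurable_measure_Diff) (auto dest: fmeasurableD simp: vol_def)
    finally show "f t - f s \<le> (2 * t) ^ d - (2 * s) ^ d" .
  qed
  have lip: "dist (f s) (f t) \<le> dist ((2 * s) ^ d) ((2 * t) ^ d)" if "0 \<le> s" "0 \<le> t" for s t :: real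
    using step[of s t] step[of t s] that by (cases "s \<le> t") (auto simp: dist_real_def)
  have "continuous_on {0..T} f"
  proof -
    have "continuous_on {0..T} (\<lambda>t. (2 * t) ^ d)" by (intro continuous_intros)
    then show ?thesis
      unfolding continuous_on_iff using lip by (meson atLeastAtMost_iff order_le_less_trans)
  qed
  moreover have "f 0 \<le> 1"
  proof -
    have "f 0 \<le> vol d (cube d 0)" unfolding f_def
      by (rule vol_mono) (use assms in \<open>auto simp: compact_cube cube_subset_E compact_Int\<close>)
    also have "\<dots> = 0" using assms by (simp add: vol_cube)
    finally show ?thesis by simp
  qed
  moreover have "f T \<ge> 1" using T assms by (simp add: f_def Int_absorb2)
  ultimately obtain t where "0 \<le> t" "f t = 1" using IVT'[of f 0 1 T] T by auto
  then show ?thesis by (auto simp: f_def)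
qed

text \<open>
  Let \<open>D\<close> be the part of \<open>X\<close> that is lost when \<open>X\<close> is intersected with its translate by \<open>w / m\<close>. On each
  line parallel to \<open>w\<close> it is the initial piece of length at most \<open>1 / m\<close>, in units of \<open>w\<close>, of the segment cut out of
  \<open>X\<close>, so the translates of \<open>D\<close> by \<open>0, w / m, \<dots>, (m - 1) w / m\<close> are disjoint; they all lie in \<open>B\<close>.
  This bounds the loss without slicing or projecting \<open>X\<close>.
\<close>
lemma shift_loss:
  fixes m :: nat
  assumes X: "convex_compact d X" and w: "w \<in> E d" and m: "m \<ge> 1"
    and B: "B \<in> sets borel" and XB: "\<And>x s. x \<in> X \<Longrightarrow> 0 \<le> s \<Longrightarrow> s \<le> 1 \<Longrightarrow> x + s *\<^sub>R w \<in> B"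
  shows "of_nat m * emeasure (mu d) {x \<in> X. x - (1 / m) *\<^sub>R w \<notin> X} \<le> emeasure (mu d) B"
proof -
  define D where "D = {x \<in> X. x - (1 / m) *\<^sub>R w \<notin> X}"
  have D_eq: "D = X - (\<lambda>x. (1 / m) *\<^sub>R w + 1 *\<^sub>R x) ` X"
    unfolding affine_image_eq_vimage[OF one_neq_zero] by (auto simp: D_def)
  have Xb: "X \<in> sets borel" using X by (simp add: convex_compact_def borel_compact)
  have Db: "D \<in> sets borel" unfolding D_eq using Xb by (intro sets.Diff borel_affine_image) auto
  define S where "S k = (\<lambda>x. (k / m) *\<^sub>R w + 1 *\<^sub>R x) ` D" for k :: nat
  have Sb: "S k \<in> sets borel" for k unfolding S_def using Db by (intro borel_affine_image) auto
  have mS: "emeasure (mu d) (S k) = emeasure (mu d) D" for k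
    unfolding S_def using emeasure_mu_affine[OF one_neq_zero E_scale[OF w] Db] by simp
  have disj: "S j \<inter> S k = {}" if jk: "j < k" for j k
  proof (rule ccontr)
    assume "S j \<inter> S k \<noteq> {}"
    then obtain p q where pq: "p \<in> D" "q \<in> D" "(j / m) *\<^sub>R w + p = (k / m) *\<^sub>R w + q"
      by (auto simp: S_def)
    \<comment> \<open>The point \<open>p - w / m\<close> lies between \<open>q\<close> and \<open>p\<close>, hence in the convex set \<open>X\<close>, but \<open>p\<close> is a lost point.\<close>
    define l where "l = real k - real j"
    have l: "l \<ge> 1" using jk by (simp add: l_def)
    have p: "p = q + (l / m) *\<^sub>R w"
      using pq(3) by (simp add: l_def diff_divide_distrib scaleR_diff_left algebra_simps)
    have "p - (1 / m) *\<^sub>R w = (1 / l) *\<^sub>R q + (1 - 1 / l) *\<^sub>R p"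
      unfolding p using l m by (auto simp: fun_eq_iff divide_simps) (auto simp: algebra_simps)
    also have "\<dots> \<in> X" using pq l X
      by (intro convexD) (auto simp: D_def convex_compact_def)
    finally show False using pq by (simp add: D_def)
  qed
  have "disjoint_family_on S {..<m}"
    unfolding disjoint_family_on_def using disj by (metis Int_commute linorder_neqE_nat)
  then have "(\<Sum>k<m. emeasure (mu d) (S k)) = emeasure (mu d) (\<Union>k<m. S k)"
    using Sb by (intro sum_emeasure) auto
  also have "\<dots> \<le> emeasure (mu d) B"
  proof (rule emeasure_mono)
    show "(\<Union>k<m. S k) \<subseteq> B"
      using XB by (auto simp: S_def D_def add.commute)
  qed (use B in simp)
  finally show ?thesis by (simp add: mS D_def)
qed

text \<open>
  If each point of \<open>X\<close> were lost under one of the translations, the lost parts would cover \<open>X\<close>, and by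
  \<open>shift_loss\<close> they are too small for that.
\<close>
lemma erosion_nonempty:
  fixes m :: nat
  assumes X: "convex_compact d X" and m: "m \<ge> 1" and K: "finite K"
    and w: "\<And>k. k \<in> K \<Longrightarrow> w k \<in> E d" 
    and B: "compact B" "B \<subseteq> E d"
    and XB: "\<And>k x s. k \<in> K \<Longrightarrow> x \<in> X \<Longrightarrow> 0 \<le> s \<Longrightarrow> s \<le> 1 \<Longrightarrow> x + s *\<^sub>R w k \<in> B"
    and large: "card K * vol d B < m * vol d X"
  shows "\<exists>x\<in>X. \<forall>k\<in>K. x - (1 / m) *\<^sub>R w k \<in> X"
proof (rule ccontr)
  assume neg: "\<not> ?thesis"
  define D where "D k = {x \<in> X. x - (1 / m) *\<^sub>R w k \<notin> X}" for k
  have Xb: "X \<in> sets borel" using X by (simp add: convex_compact_def borel_compact)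
  have Db: "D k \<in> sets borel" for k
  proof -
    have "D k = X - (\<lambda>x. (1 / m) *\<^sub>R w k + 1 *\<^sub>R x) ` X"
      unfolding affine_image_eq_vimage[OF one_neq_zero] by (auto simp: D_def)
    then show ?thesis using Xb borel_affine_image[OF one_neq_zero Xb] by (metis sets.Diff)
  qed
  have "emeasure (mu d) X \<le> emeasure (mu d) (\<Union>k\<in>K. D k)"
    using neg Db K by (intro emeasure_mono) (auto simp: D_def)
  also have "\<dots> \<le> (\<Sum>k\<in>K. emeasure (mu d) (D k))"
    using Db K by (intro emeasure_subadditive_finite) auto
  finally have "of_nat m * emeasure (mu d) X \<le> of_nat m * (\<Sum>k\<in>K. emeasure (mu d) (D k))"
    by (rule mult_left_mono) simp
  also have "\<dots> = (\<Sum>k\<in>K. of_nat m * emeasure (mu d) (D k))" by (rule sum_distrib_left)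
  also have "\<dots> \<le> (\<Sum>k\<in>K. emeasure (mu d) B)"
    unfolding D_def using X w m B XB by (intro sum_mono shift_loss) (auto simp: borel_compact)
  also have "\<dots> = ennreal (card K * vol d B)"
    using emeasure_eq_vol[OF B] by (simp add: ennreal_mult ennreal_of_nat_eq_real_of_nat vol_nonneg)
  also have "of_nat m * emeasure (mu d) X = ennreal (m * vol d X)"
    using emeasure_eq_vol[of X d] X 
    by (simp add: convex_compact_def ennreal_mult ennreal_of_nat_eq_real_of_nat vol_nonneg)
  finally show False using large by (simp add: vol_nonneg)
qed

section \<open>Frames of maximal determinant\<close>

definition colmat :: "nat \<Rightarrow> (nat \<Rightarrow> nat \<Rightarrow> real) \<Rightarrow> real Matrix.mat" where
  "colmat d u = Matrix.mat d d (\<lambda>(r, c). u c r)"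

lemma continuous_on_det_colmat: "continuous_on S (\<lambda>u. Determinant.det (colmat d u))"
proof -
  have eq: "Determinant.det (colmat d u) =
      (\<Sum>p\<in>{p. p permutes {0..<d}}. signof p * (\<Prod>i = 0..<d. u (p i) i))" for u
  proof -
    have "(\<Prod>i = 0..<d. Matrix.mat d d (\<lambda>(r, c). u c r) $$ (i, p i)) = (\<Prod>i = 0..<d. u (p i) i)"
      if "p permutes {0..<d}" for p
    proof (rule prod.cong[OF refl])
      fix i assume "i \<in> {0..<d}"
      moreover from this have "p i \<in> {0..<d}" using permutes_in_image[OF that] by blast
      ultimately show "Matrix.mat d d (\<lambda>(r, c). u c r) $$ (i, p i) = u (p i) i" by simp
    qed
    then show ?thesis
      unfolding Determinant.det_def colmat_def dim_row_mat dim_col_mat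
      by (simp only: if_True refl) (rule sum.cong, auto)
  qed
  have c: "continuous_on S (\<lambda>u :: nat \<Rightarrow> nat \<Rightarrow> real. u c r)" for c r
    by (rule continuous_on_product_then_coordinatewise[OF
        continuous_on_product_then_coordinatewise[OF continuous_on_id]])
  show ?thesis
    unfolding eq
    by (rule continuous_on_sum, rule continuous_on_mult[OF continuous_on_const],
        rule continuous_on_prod, rule c)
qed

lemma invertible_matrix:
  fixes A :: "real Matrix.mat"
  assumes A: "A \<in> carrier_mat d d" and det: "Determinant.det A \<noteq> 0"
  shows "\<exists>B\<in>carrier_mat d d. A * B = 1\<^sub>m d \<and> B * A = 1\<^sub>m d"
  using det_non_zero_imp_unit[OF A det, of "()"]
  by (auto simp: Units_def ring_mat_def)

text \<open>
  Auerbach's argument: choose the \<open>u i\<close> in \<open>P\<close> with the largest absolute determinant. By Cramer's rule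
  the coordinates of \<open>v\<close> are quotients of determinants, where the numerator has \<open>v\<close> in place of one
  \<open>u i\<close> and cannot exceed the denominator. The hypothesis on the axis vectors makes the maximum positive.
  The point \<open>y\<close> is the vertex at which the hyperplanes \<open>ip d y (u i) = 1\<close> meet.
\<close>
lemma bounded_coordinates_basis:
  assumes P: "compact P" "P \<subseteq> E d" and r: "r \<noteq> 0" "\<And>i. i < d \<Longrightarrow> r *\<^sub>R ax i \<in> P" and "d \<ge> 1"
  shows "\<exists>u. (\<forall>i<d. u i \<in> P) \<and>
    (\<forall>v\<in>P. \<exists>a. (\<forall>i<d. \<bar>a i\<bar> \<le> 1) \<and> v = (\<Sum>i<d. a i *\<^sub>R u i)) \<and>
    (\<exists>y\<in>E d. \<forall>i<d. ip d y (u i) = 1)"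
proof -
  define D where "D u = Determinant.det (colmat d u)" for u
  let ?T = "PiE UNIV (\<lambda>_. P) :: (nat \<Rightarrow> nat \<Rightarrow> real) set"
  define u0 where "u0 i = (if i < d then r *\<^sub>R ax i else r *\<^sub>R ax 0)" for i
  have u0: "u0 \<in> ?T" using r \<open>d \<ge> 1\<close> by (auto simp: u0_def)
  have "compact ?T" using P by (intro compact_PiE_UNIV)
  moreover have "continuous_on ?T (\<lambda>u. \<bar>D u\<bar>)"
    unfolding D_def by (intro continuous_intros continuous_on_det_colmat)
  ultimately obtain u where u: "u \<in> ?T" and max: "\<And>u'. u' \<in> ?T \<Longrightarrow> \<bar>D u'\<bar> \<le> \<bar>D u\<bar>"
    using continuous_attains_sup[of ?T "\<lambda>u. \<bar>D u\<bar>"] u0 by blast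
  have uP: "u i \<in> P" for i using u by auto
  define U where "U = colmat d u"
  have Uc: "U \<in> carrier_mat d d" by (simp add: U_def colmat_def)
  have "colmat d u0 = r \<cdot>\<^sub>m 1\<^sub>m d"
    by (rule eq_matI) (auto simp: colmat_def u0_def ax_def)
  then have "D u0 = r ^ d" by (simp add: D_def Determinant.det_smult)
  then have det: "Determinant.det U \<noteq> 0" using max[OF u0] r by (auto simp: D_def U_def)
  obtain B where B: "B \<in> carrier_mat d d" "U * B = 1\<^sub>m d" "B * U = 1\<^sub>m d"
    using invertible_matrix[OF Uc det] by auto
  have coords: "\<exists>a. (\<forall>i<d. \<bar>a i\<bar> \<le> 1) \<and> v = (\<Sum>i<d. a i *\<^sub>R u i)" if v: "v \<in> P" for v
  proof -
    define x where "x = B *\<^sub>v Matrix.vec d v"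
    have xc: "x \<in> carrier_vec d" using B by (simp add: x_def)
    have Ux: "U *\<^sub>v x = Matrix.vec d v"
    proof -
      have "U *\<^sub>v x = (U * B) *\<^sub>v Matrix.vec d v"
        unfolding x_def using Uc B by (intro assoc_mult_mat_vec[symmetric]) auto
      then show ?thesis using B by simp
    qed
    define a where "a i = vec_index x i" for i
    have "v = (\<Sum>i<d. a i *\<^sub>R u i)"
    proof (rule E_eqI)
      show "v \<in> E d" using v P by auto
      show "(\<Sum>i<d. a i *\<^sub>R u i) \<in> E d" using uP P by (intro E_sum E_scale) auto
      fix j assume j: "j < d"
      have "v j = vec_index (U *\<^sub>v x) j" using j by (simp add: Ux)
      also have "\<dots> = (\<Sum>i<d. a i *\<^sub>R u i) j"
        using j xc by (simp add: U_def colmat_def scalar_prod_def a_def sum_fun_apply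
            mult.commute atLeast0LessThan)
      finally show "v j = (\<Sum>i<d. a i *\<^sub>R u i) j" .
    qed
    moreover have "\<bar>a i\<bar> \<le> 1" if i: "i < d" for i
    proof -
      have "replace_col U (U *\<^sub>v x) i = colmat d (u(i := v))"
        unfolding Ux by (rule eq_matI) (auto simp: replace_col_def U_def colmat_def)
      then have "D (u(i := v)) = a i * D u"
        using cramer_lemma_mat[OF Uc xc i] by (simp add: D_def U_def a_def)
      moreover have "\<bar>D (u(i := v))\<bar> \<le> \<bar>D u\<bar>" using uP v by (intro max) auto
      ultimately have "\<bar>a i\<bar> * \<bar>D u\<bar> \<le> 1 * \<bar>D u\<bar>" by (simp add: abs_mult)
      then show ?thesis using det by (simp add: D_def U_def)
    qed
    ultimately show ?thesis by blast
  qed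
  define y where "y j = (if j < d then \<Sum>i<d. B $$ (i, j) else 0)" for j
  have "y \<in> E d" by (simp add: y_def E_def)
  moreover have "ip d y (u c) = 1" if c: "c < d" for c
  proof -
    have "ip d y (u c) = (\<Sum>j<d. \<Sum>i<d. B $$ (i, j) * u c j)"
      by (simp add: ip_def y_def sum_distrib_right)
    also have "\<dots> = (\<Sum>i<d. \<Sum>j<d. B $$ (i, j) * u c j)" by (rule sum.swap)
    also have "\<dots> = (\<Sum>i<d. (B * U) $$ (i, c))"
      using B(1) Uc c by (auto intro!: sum.cong simp: U_def colmat_def scalar_prod_def atLeast0LessThan)
    also have "\<dots> = (\<Sum>i<d. if i = c then 1 else 0)" using c by (simp add: B(3))
    also have "\<dots> = 1" using c by simp
    finally show ?thesis .
  qed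
  ultimately show ?thesis using uP coords by blast
qed

section \<open>Polarity and centers\<close>

lemma convex_compact_affine:
  assumes "convex_compact d A" "a \<in> E d"
  shows "convex_compact d ((\<lambda>x. a + r *\<^sub>R x) ` A)"
  using assms unfolding convex_compact_def
  by (auto intro!: convex_affinity compact_continuous_image continuous_on_affine_fun E_add E_scale)

lemma convex_compact_translate:
  assumes "convex_compact d A" "p \<in> E d"
  shows "convex_compact d {x. p + x \<in> A}"
proof -
  have "{x. p + x \<in> A} = (\<lambda>x. - p + 1 *\<^sub>R x) ` A"
    unfolding affine_image_eq_vimage[OF one_neq_zero] by (auto simp: add.commute)
  then show ?thesis using convex_compact_affine[OF assms(1) E_minus[OF assms(2)], of 1] by argo
qed

text \<open>
  Among more than \<open>d\<close> vectors there is a dependency, and up to sign its coefficients have a nonnegative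
  sum. Subtracting the multiple of it that first makes a coefficient vanish removes a vector, keeps the
  combination, and does not increase the total weight. As the total weight is only bounded, \<open>d\<close> vectors
  remain instead of the \<open>d + 1\<close> of the affine version.
\<close>
lemma caratheodory_reduction:
  assumes "finite J" "\<And>j. j \<in> J \<Longrightarrow> v j \<in> E d" "\<And>j. j \<in> J \<Longrightarrow> 0 \<le> c j"
  shows "\<exists>I c'. I \<subseteq> J \<and> card I \<le> d \<and> (\<forall>j\<in>I. 0 \<le> c' j) \<and> sum c' I \<le> sum c J \<and>
    (\<Sum>j\<in>I. c' j *\<^sub>R v j) = (\<Sum>j\<in>J. c j *\<^sub>R v j)"
  using assms
proof (induction "card J" arbitrary: J c rule: less_induct)
  case less
  show ?case
  proof (cases "card J \<le> d")
    case True
    then show ?thesis using less.prems by (intro exI[of _ J] exI[of _ c]) auto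
  next
    case False
    then obtain e0 where e0: "\<exists>j\<in>J. e0 j \<noteq> 0" "(\<Sum>j\<in>J. e0 j *\<^sub>R v j) = 0"
      using E_dependency[of J d v] less.prems by (metis not_le)
    define e where "e = (if sum e0 J \<ge> 0 then e0 else (\<lambda>j. - e0 j))"
    have e: "\<exists>j\<in>J. e j \<noteq> 0" "(\<Sum>j\<in>J. e j *\<^sub>R v j) = 0" "sum e J \<ge> 0"
      using e0 by (auto simp: e_def sum_negf)
    define Q where "Q = {j\<in>J. e j > 0}"
    have "Q \<noteq> {}"
    proof
      assume "Q = {}"
      then have neg: "\<And>j. j \<in> J \<Longrightarrow> 0 \<le> - e j" by (force simp: Q_def)
      then have "sum (\<lambda>j. - e j) J \<ge> 0" by (intro sum_nonneg) auto
      then have "sum (\<lambda>j. - e j) J = 0" using e(3) by (simp add: sum_negf)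
      then have "\<forall>j\<in>J. - e j = 0"
        using neg less.prems(1) sum_nonneg_eq_0_iff[of J "\<lambda>j. - e j"] by blast
      then show False using e(1) by auto
    qed
    moreover have "finite Q" using less.prems(1) by (simp add: Q_def)
    ultimately obtain i where i: "i \<in> Q" "\<And>j. j \<in> Q \<Longrightarrow> c i / e i \<le> c j / e j"
      using arg_min_if_finite[of Q "\<lambda>j. c j / e j"] by (metis not_less)
    define t where "t = c i / e i"
    have t: "t \<ge> 0" using i(1) less.prems(3) by (auto simp: t_def Q_def)
    define c1 where "c1 j = c j - t * e j" for j
    have iJ: "i \<in> J" and ei: "e i > 0" using i by (auto simp: Q_def)
    have c1i: "c1 i = 0" using ei by (simp add: c1_def t_def)
    have c1: "0 \<le> c1 j" if "j \<in> J" for j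
    proof (cases "j \<in> Q")
      case True
      then have "t \<le> c j / e j" "e j > 0" using i by (auto simp: t_def Q_def)
      then show ?thesis by (simp add: c1_def field_simps)
    next
      case False
      then have "t * e j \<le> 0" using that t by (intro mult_nonneg_nonpos) (auto simp: Q_def)
      then show ?thesis using less.prems(3)[OF that] by (simp add: c1_def)
    qed
    have "\<exists>I c'. I \<subseteq> J - {i} \<and> card I \<le> d \<and> (\<forall>j\<in>I. 0 \<le> c' j) \<and> sum c' I \<le> sum c1 (J - {i}) \<and>
      (\<Sum>j\<in>I. c' j *\<^sub>R v j) = (\<Sum>j\<in>J - {i}. c1 j *\<^sub>R v j)"
      using less.prems c1 card_Diff1_less[OF less.prems(1) iJ] by (intro less.hyps) auto
    moreover have "sum c1 (J - {i}) = sum c1 J"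
      using iJ less.prems(1) c1i by (simp add: sum.remove)
    moreover have "sum c1 J \<le> sum c J"
      using t e(3) by (simp add: c1_def sum_subtractf flip: sum_distrib_left)
    moreover have "(\<Sum>j\<in>J - {i}. c1 j *\<^sub>R v j) = (\<Sum>j\<in>J. c1 j *\<^sub>R v j)"
      using iJ less.prems(1) c1i by (subst (2) sum.remove) auto
    moreover have "(\<Sum>j\<in>J. c1 j *\<^sub>R v j) = (\<Sum>j\<in>J. c j *\<^sub>R v j)"
    proof -
      have "(\<Sum>j\<in>J. c1 j *\<^sub>R v j) = (\<Sum>j\<in>J. c j *\<^sub>R v j) - t *\<^sub>R (\<Sum>j\<in>J. e j *\<^sub>R v j)"
        by (simp add: c1_def scaleR_diff_left sum_subtractf scaleR_right.sum)
      then show ?thesis using e(2) by simp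
    qed
    ultimately show ?thesis by (smt (verit, ccfv_SIG) Diff_subset order_trans)
  qed
qed

text \<open>
  For nonempty \<open>P \<subseteq> E d\<close> and \<open>d \<ge> 1\<close> this is the convex hull of \<open>P \<union> {0}\<close>. The fixed number of summands
  makes it a continuous image of a compact set and provides the \<open>d\<close> vectors that
  \<open>quantitative_helly_centered\<close> counts.
\<close>
definition zero_hull :: "nat \<Rightarrow> (nat \<Rightarrow> real) set \<Rightarrow> (nat \<Rightarrow> real) set" where
  "zero_hull d P = {\<Sum>k<d. c k *\<^sub>R v k | c v. (\<forall>k<d. 0 \<le> c k \<and> v k \<in> P) \<and> sum c {..<d} \<le> 1}"

lemma zero_hull_I:
  assumes P: "P \<subseteq> E d" "P \<noteq> {}" and J: "finite J" "\<And>j. j \<in> J \<Longrightarrow> v j \<in> P"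
    and c: "\<And>j. j \<in> J \<Longrightarrow> 0 \<le> c j" "sum c J \<le> 1"
  shows "(\<Sum>j\<in>J. c j *\<^sub>R v j) \<in> zero_hull d P"
proof -
  have "\<And>j. j \<in> J \<Longrightarrow> v j \<in> E d" using J P by blast
  from caratheodory_reduction[where v = v and c = c, OF J(1) this c(1)]
  obtain I c' where I: "I \<subseteq> J" "card I \<le> d" "\<forall>j\<in>I. 0 \<le> c' j" "sum c' I \<le> sum c J"
    "(\<Sum>j\<in>I. c' j *\<^sub>R v j) = (\<Sum>j\<in>J. c j *\<^sub>R v j)" by blast
  have finI: "finite I" using I J finite_subset by blast
  obtain h where h: "bij_betw h {..<card I} I"
    using ex_bij_betw_nat_finite[OF finI] by (auto simp: atLeast0LessThan)
  obtain p where p: "p \<in> P" using P by auto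
  define c2 where "c2 k = (if k < card I then c' (h k) else 0)" for k
  define v2 where "v2 k = (if k < card I then v (h k) else p)" for k
  have hI: "h k \<in> I" if "k < card I" for k using h that by (auto simp: bij_betw_def)
  have "(\<Sum>k<d. c2 k *\<^sub>R v2 k) = (\<Sum>k<card I. c2 k *\<^sub>R v2 k)"
    by (rule sum.mono_neutral_right) (use I in \<open>auto simp: c2_def\<close>)
  also have "\<dots> = (\<Sum>k<card I. c' (h k) *\<^sub>R v (h k))" by (simp add: c2_def v2_def)
  also have "\<dots> = (\<Sum>j\<in>I. c' j *\<^sub>R v j)" by (rule sum.reindex_bij_betw[OF h])
  finally have 1: "(\<Sum>j\<in>J. c j *\<^sub>R v j) = (\<Sum>k<d. c2 k *\<^sub>R v2 k)" using I by simp
  have "sum c2 {..<d} = sum c2 {..<card I}"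
    by (rule sum.mono_neutral_right) (use I in \<open>auto simp: c2_def\<close>)
  also have "\<dots> = (\<Sum>k<card I. c' (h k))" by (simp add: c2_def)
  also have "\<dots> = sum c' I" by (rule sum.reindex_bij_betw[OF h])
  finally have 2: "sum c2 {..<d} \<le> 1" using I c by simp
  have "\<forall>k<d. 0 \<le> c2 k \<and> v2 k \<in> P"
    using I hI J p by (auto simp: c2_def v2_def)
  then show ?thesis unfolding zero_hull_def using 1 2 by blast
qed

lemma convex_compact_zero_hull:
  assumes P: "compact P" "P \<subseteq> E d" "P \<noteq> {}"
  shows "convex_compact d (zero_hull d P)"
  unfolding convex_compact_def
proof (intro conjI)
  show "zero_hull d P \<subseteq> E d"
    using P(2) by (auto simp: zero_hull_def intro!: E_sum E_scale)
  show "convex (zero_hull d P)"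
  proof (rule convexI)
    fix x y and a b :: real
    assume *: "x \<in> zero_hull d P" "y \<in> zero_hull d P" "0 \<le> a" "0 \<le> b" "a + b = 1"
    then obtain c v c' v' where
      x: "x = (\<Sum>k<d. c k *\<^sub>R v k)" "\<forall>k<d. 0 \<le> c k \<and> v k \<in> P" "sum c {..<d} \<le> 1" and
      y: "y = (\<Sum>k<d. c' k *\<^sub>R v' k)" "\<forall>k<d. 0 \<le> c' k \<and> v' k \<in> P" "sum c' {..<d} \<le> 1"
      unfolding zero_hull_def by blast
    define C where "C = case_sum (\<lambda>k. a * c k) (\<lambda>k. b * c' k)"
    define V where "V = case_sum v v'"
    have "(\<Sum>j\<in>{..<d} <+> {..<d}. C j *\<^sub>R V j) \<in> zero_hull d P"
    proof (rule zero_hull_I[OF P(2,3)])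
      have "sum C ({..<d} <+> {..<d}) = a * sum c {..<d} + b * sum c' {..<d}"
        by (simp add: sum.Plus C_def sum_distrib_left)
      also have "\<dots> \<le> a * 1 + b * 1" using * x y by (intro add_mono mult_left_mono) auto
      finally show "sum C ({..<d} <+> {..<d}) \<le> 1" using * by simp
    qed (use x y * in \<open>auto simp: C_def V_def\<close>)
    also have "(\<Sum>j\<in>{..<d} <+> {..<d}. C j *\<^sub>R V j) = a *\<^sub>R x + b *\<^sub>R y"
      unfolding x(1) y(1) by (simp add: sum.Plus C_def V_def scaleR_right.sum)
    finally show "a *\<^sub>R x + b *\<^sub>R y \<in> zero_hull d P" .
  qed
  let ?C = "{c \<in> PiE UNIV (\<lambda>_. {0..1}). sum c {..<d} \<le> 1} :: (nat \<Rightarrow> real) set"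
  let ?V = "PiE UNIV (\<lambda>_. P) :: (nat \<Rightarrow> nat \<Rightarrow> real) set"
  let ?f = "\<lambda>(c, v). \<Sum>k<d. c k *\<^sub>R v k :: nat \<Rightarrow> real"
  have "zero_hull d P = ?f ` (?C \<times> ?V)"
  proof (intro equalityI subsetI)
    fix x assume "x \<in> zero_hull d P"
    then obtain c v where
      x: "x = (\<Sum>k<d. c k *\<^sub>R v k)" "\<forall>k<d. 0 \<le> c k \<and> v k \<in> P" "sum c {..<d} \<le> 1"
      unfolding zero_hull_def by blast
    obtain p where p: "p \<in> P" using P by auto
    define c2 where "c2 k = (if k < d then c k else 0)" for k
    define v2 where "v2 k = (if k < d then v k else p)" for k
    have "c k \<le> 1" if "k < d" for k
      using member_le_sum[of k "{..<d}" c] x that by auto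
    then have "c2 \<in> ?C" using x by (auto simp: c2_def)
    moreover have "v2 \<in> ?V" using x p by (auto simp: v2_def)
    moreover have "x = ?f (c2, v2)" using x by (simp add: c2_def v2_def)
    ultimately show "x \<in> ?f ` (?C \<times> ?V)" by blast
  next
    fix x assume "x \<in> ?f ` (?C \<times> ?V)"
    then show "x \<in> zero_hull d P" unfolding zero_hull_def by (auto simp: PiE_iff)
  qed
  moreover have "compact (?f ` (?C \<times> ?V))"
  proof (rule compact_continuous_image)
    have "?C = PiE UNIV (\<lambda>_. {0..1}) \<inter> {c. sum c {..<d} \<le> 1}" by auto
    moreover have "closed {c :: nat \<Rightarrow> real. sum c {..<d} \<le> 1}"
      by (intro closed_Collect_le continuous_intros continuous_on_product_coordinates)
    ultimately have "compact ?C" by (auto intro!: compact_Int_closed compact_PiE_UNIV)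
    then show "compact (?C \<times> ?V)" using P(1) by (intro compact_Times compact_PiE_UNIV)
    show "continuous_on (?C \<times> ?V) ?f"
      unfolding case_prod_unfold
      by (intro continuous_on_sum_fun continuous_on_scale_fun
          continuous_on_product_then_coordinatewise[OF continuous_on_fst]
          continuous_on_product_then_coordinatewise[OF continuous_on_snd] continuous_on_id)
  qed
  ultimately show "compact (zero_hull d P)" by simp
qed

definition polar :: "nat \<Rightarrow> (nat \<Rightarrow> real) set \<Rightarrow> (nat \<Rightarrow> real) set" where
  "polar d A = {u \<in> E d. \<forall>x\<in>A. ip d u x \<le> 1}"

lemma compact_polar:
  assumes "e > 0" "\<And>i. i < d \<Longrightarrow> e *\<^sub>R ax i \<in> A \<and> - (e *\<^sub>R ax i) \<in> A"
  shows "compact (polar d A)"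
proof -
  have "polar d A \<subseteq> cube d (1 / e)"
  proof
    fix u assume u: "u \<in> polar d A"
    have "\<bar>u i\<bar> \<le> 1 / e" if "i < d" for i
    proof -
      have "ip d u (e *\<^sub>R ax i) \<le> 1" "ip d u (- (e *\<^sub>R ax i)) \<le> 1"
        using u assms(2)[OF that] by (auto simp: polar_def)
      then show ?thesis using assms(1) that by (simp add: ip_simps ip_ax field_simps abs_le_iff)
    qed
    then show "u \<in> cube d (1 / e)" using u by (auto simp: polar_def cube_def)
  qed
  moreover have "closed (polar d A)"
  proof -
    have "polar d A = E d \<inter> (\<Inter>x\<in>A. {u. ip d u x \<le> 1})" by (auto simp: polar_def)
    then show ?thesis
      by (auto intro!: closed_Int closed_E closed_INT closed_Collect_le continuous_intros)
  qed
  ultimately show ?thesis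
    using compact_Int_closed[OF compact_cube] by (metis inf.absorb_iff2)
qed

text \<open>
  A functional that separates \<open>x\<close> from \<open>A\<close> has a nonnegative supremum over \<open>A\<close>, because \<open>0\<close> is in
  \<open>A\<close>; so it can be scaled into the polar and still exceed \<open>1\<close> at \<open>x\<close>.
\<close>
lemma bipolar:
  assumes A: "convex_compact d A" "0 \<in> A" and x: "x \<in> E d" "\<And>u. u \<in> polar d A \<Longrightarrow> ip d u x \<le> 1"
  shows "x \<in> A"
proof (rule ccontr)
  assume "x \<notin> A"
  then obtain u b where u: "u \<in> E d" "\<forall>y\<in>A. ip d u y \<le> b" "b < ip d u x"
    using separation[OF A(1) _ x(1)] A(2) by blast
  have "b \<ge> 0" using u(2) A(2) by force
  \<comment> \<open>The bound \<open>b\<close> may be \<open>0\<close>; scaling by a value strictly between it and \<open>ip d u x\<close> avoids this case.\<close>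
  define g where "g = (b + ip d u x) / 2"
  have g: "b < g" "g < ip d u x" "g > 0" using u \<open>b \<ge> 0\<close> by (auto simp: g_def)
  have "(1 / g) *\<^sub>R u \<in> polar d A"
    using u g by (force simp: polar_def ip_simps E_scale divide_simps)
  from x(2)[OF this] show False using g by (simp add: ip_simps)
qed

text \<open>
  The required \<open>p\<close> are the common points of the sets \<open>(x + d X) / (d + 1)\<close> for \<open>x\<close> in \<open>X\<close>. Any \<open>d + 1\<close> of
  these contain the centroid of the corresponding points \<open>x\<close>, so Helly's theorem applies to
  finitely many, and compactness to all of them.
\<close>
lemma center_exists:
  assumes X: "convex_compact d X" "X \<noteq> {}" and "d \<ge> 1"
  shows "\<exists>p\<in>X. \<forall>x\<in>X. p - (1 / d) *\<^sub>R (x - p) \<in> X"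
proof -
  define G where "G x = (\<lambda>z. (1 / (d + 1)) *\<^sub>R x + (d / (d + 1)) *\<^sub>R z) ` X" for x
  have XE: "X \<subseteq> E d" and Xc: "convex X" using X by (auto simp: convex_compact_def)
  have G: "convex_compact d (G x)" if "x \<in> X" for x
    unfolding G_def using X that XE by (intro convex_compact_affine E_scale) auto
  have GX: "G x \<subseteq> X" if "x \<in> X" for x
    unfolding G_def using that Xc by (auto intro!: convexD simp: field_simps)
  have "X \<inter> \<Inter>(G ` X) \<noteq> {}"
  proof (rule compact_imp_fip)
    show "compact X" using X by (simp add: convex_compact_def)
    fix T assume "T \<in> G ` X"
    then show "closed T" using G by (auto simp: convex_compact_def intro: compact_imp_closed)
  next
    fix F assume F: "finite F" "F \<subseteq> G ` X"
    then obtain J where J: "J \<subseteq> X" "finite J" "F = G ` J" by (meson finite_subset_image)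
    show "X \<inter> \<Inter>F \<noteq> {}"
    proof (cases "J = {}")
      case True then show ?thesis using J X by simp
    next
      case False
      have "(\<Inter>x\<in>J. G x) \<noteq> {}"
      proof (rule helly[where d = d])
        fix I assume I: "I \<subseteq> J" "I \<noteq> {}" "card I \<le> d + 1"
        obtain x0 where x0: "x0 \<in> I" using I by auto
        have finI: "finite I" using I J finite_subset by auto
        define k where "k = card I"
        \<comment> \<open>If \<open>I\<close> has fewer than \<open>d + 1\<close> points, \<open>x0\<close> is repeated in the centroid to fill up.\<close>
        define a where "a j = 1 / (d + 1) + (if j = x0 then (d + 1 - real k) / (d + 1) else 0)" for j
        define c where "c = (\<Sum>j\<in>I. a j *\<^sub>R j)"
        have "c \<in> G x" if x: "x \<in> I" for x
        proof -
          define b where "b j = (if j = x then 0 else 1 / d) + (if j = x0 then (d + 1 - real k) / d else 0)" for j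
          have "(\<Sum>j\<in>I. b j *\<^sub>R j) \<in> X"
          proof (rule convex_sum[OF finI Xc])
            have "sum b I = (\<Sum>j\<in>I. 1 / d - (if j = x then 1 / d else 0) + (if j = x0 then (d + 1 - real k) / d else 0))"
              by (intro sum.cong) (auto simp: b_def)
            also have "\<dots> = k / d - 1 / d + (d + 1 - real k) / d"
              using finI x x0 by (simp add: sum.distrib sum_subtractf k_def)
            also have "\<dots> = 1" using \<open>d \<ge> 1\<close> by (simp add: field_simps)
            finally show "sum b I = 1" .
            show "0 \<le> b j" for j using I(3) by (auto simp: b_def k_def)
            show "j \<in> X" if "j \<in> I" for j using that I J by auto
          qed
          moreover have "c = (1 / (d + 1)) *\<^sub>R x + (d / (d + 1)) *\<^sub>R (\<Sum>j\<in>I. b j *\<^sub>R j)"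
          proof -
            have ab: "a j = (if j = x then 1 / (d + 1) else 0) + d / (d + 1) * b j" for j
            proof -
              have "d / (d + 1) * (y / d) = y / (d + 1)" for y :: real using \<open>d \<ge> 1\<close> by simp
              then show ?thesis using \<open>d \<ge> 1\<close> by (simp add: a_def b_def distrib_left)
            qed
            have "c = (\<Sum>j\<in>I. (if j = x then (1 / (d + 1)) *\<^sub>R j else 0)) + (\<Sum>j\<in>I. (d / (d + 1) * b j) *\<^sub>R j)"
              unfolding c_def ab by (simp add: scaleR_add_left sum.distrib if_distrib[of "\<lambda>r. r *\<^sub>R _"] cong: if_cong)
            then show ?thesis using finI x by (simp add: scaleR_right.sum)
          qed
          ultimately show ?thesis unfolding G_def by blast
        qed
        then show "(\<Inter>x\<in>I. G x) \<noteq> {}" by blast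
      qed (use J False G in \<open>auto simp: convex_compact_def\<close>)
      then show ?thesis using J False GX by blast
    qed
  qed
  then obtain p where p: "p \<in> X" "\<And>x. x \<in> X \<Longrightarrow> p \<in> G x" by auto
  have "p - (1 / d) *\<^sub>R (x - p) \<in> X" if x: "x \<in> X" for x
  proof -
    obtain z where z: "z \<in> X" "p = (1 / (d + 1)) *\<^sub>R x + (d / (d + 1)) *\<^sub>R z"
      using p(2)[OF x] by (auto simp: G_def)
    have "(d + 1) *\<^sub>R p = x + d *\<^sub>R z"
      unfolding z(2) using \<open>d \<ge> 1\<close> by (simp add: scaleR_add_right add_nonneg_eq_0_iff)
    then have "d *\<^sub>R (p - (1 / d) *\<^sub>R (x - p)) = d *\<^sub>R z"
      using \<open>d \<ge> 1\<close> by (simp add: algebra_simps)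
    then have "p - (1 / d) *\<^sub>R (x - p) = z" using \<open>d \<ge> 1\<close> by simp
    then show ?thesis using z by simp
  qed
  then show ?thesis using p by blast
qed

section \<open>A quantitative Helly theorem\<close>

text \<open>
  Choose \<open>u i\<close> of maximal determinant from the polars of the sets. A point \<open>z\<close> with
  \<open>\<Sum>\<bar>ip d z (u i)\<bar> \<le> 1\<close> is in all sets, because each polar vector has coordinates in \<open>[-1, 1]\<close> with respect
  to the \<open>u i\<close>. The point \<open>w = - (\<Sum>u i) / d\<^sup>2\<close> is in the hull of the polars and \<open>0\<close>: otherwise some \<open>x\<close>
  in the intersection would satisfy \<open>ip d x w > 1\<close>, but \<open>- x / d\<close> is in the intersection too, which gives
  \<open>ip d x (u i) \<ge> - d\<close>. So \<open>w\<close> is a combination of at most \<open>d\<close> polar vectors \<open>v k\<close>. On the sets that provide the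
  \<open>u i\<close> and the \<open>v k\<close>, the numbers \<open>1 - ip d y (u i)\<close> are nonnegative and add up to at most \<open>d\<^sup>2 + d\<close>;
  they are the products of \<open>a - y\<close> with the \<open>u i\<close> for the vertex \<open>a\<close>.
\<close>
lemma quantitative_helly_centered:
  fixes A :: "'j \<Rightarrow> (nat \<Rightarrow> real) set"
  assumes J: "finite J" "J \<noteq> {}" and d: "d \<ge> 1"
    and cc: "\<And>j. j \<in> J \<Longrightarrow> convex_compact d (A j)"
    and e: "e > 0" "\<And>i j. i < d \<Longrightarrow> j \<in> J \<Longrightarrow> e *\<^sub>R ax i \<in> A j \<and> - (e *\<^sub>R ax i) \<in> A j"
    and sym: "\<And>x. x \<in> (\<Inter>j\<in>J. A j) \<Longrightarrow> - ((1 / d) *\<^sub>R x) \<in> (\<Inter>j\<in>J. A j)"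
  shows "\<exists>I\<subseteq>J. I \<noteq> {} \<and> card I \<le> 2 * d \<and>
    (\<exists>a\<in>E d. \<forall>y\<in>(\<Inter>j\<in>I. A j). (1 / real (d\<^sup>2 + d)) *\<^sub>R (a - y) \<in> (\<Inter>j\<in>J. A j))"
proof -
  define P where "P = (\<Union>j\<in>J. polar d (A j))"
  have AE: "A j \<subseteq> E d" if "j \<in> J" for j using cc[OF that] by (simp add: convex_compact_def)
  have zero: "0 \<in> A j" if j: "j \<in> J" for j
  proof -
    have "(1/2) *\<^sub>R (e *\<^sub>R ax 0) + (1/2) *\<^sub>R (- (e *\<^sub>R ax 0)) \<in> A j"
      using cc[OF j] e(2)[of 0 j] d j by (intro convexD) (auto simp: convex_compact_def)
    then show ?thesis by simp
  qed
  have inX: "x \<in> (\<Inter>j\<in>J. A j)" if "x \<in> E d" "\<And>u. u \<in> P \<Longrightarrow> ip d u x \<le> 1" for x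
  proof (rule INT_I)
    fix j assume "j \<in> J"
    then show "x \<in> A j" using that by (intro bipolar[OF cc zero]) (auto simp: P_def)
  qed
  have Pc: "compact P" unfolding P_def using J e by (intro compact_UN compact_polar) auto
  have PE: "P \<subseteq> E d" by (auto simp: P_def polar_def)
  have "compact (\<Union>j\<in>J. A j)" using J cc by (intro compact_UN) (auto simp: convex_compact_def)
  then obtain T where T: "T \<ge> 0" "(\<Union>j\<in>J. A j) \<subseteq> cube d T"
    using compact_subset_cube[of "\<Union>j\<in>J. A j" d] AE by blast
  have axP: "(1 / (T + 1)) *\<^sub>R ax i \<in> P" if i: "i < d" for i
  proof -
    have "ip d ((1 / (T + 1)) *\<^sub>R ax i) x \<le> 1" if "j \<in> J" "x \<in> A j" for j x
    proof -
      have "\<bar>x i\<bar> \<le> T" using T that i by (auto simp: cube_def)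
      then show ?thesis using i T by (simp add: ip_simps ip_commute[of d "ax i"] ip_ax field_simps)
    qed
    then show ?thesis using J i by (auto simp: P_def polar_def E_scale ax_in_E)
  qed
  obtain u a where u: "\<And>i. i < d \<Longrightarrow> u i \<in> P"
    and coords: "\<And>v. v \<in> P \<Longrightarrow> \<exists>b. (\<forall>i<d. \<bar>b i\<bar> \<le> 1) \<and> v = (\<Sum>i<d. b i *\<^sub>R u i)"
    and a: "a \<in> E d" "\<And>i. i < d \<Longrightarrow> ip d a (u i) = 1"
  proof -
    have "1 / (T + 1) \<noteq> 0" using T(1) by simp
    from bounded_coordinates_basis[OF Pc PE this axP d] show ?thesis using that by blast
  qed
  define w where "w = - ((1 / d\<^sup>2) *\<^sub>R (\<Sum>i<d. u i))"
  have wE: "w \<in> E d" unfolding w_def using u PE by (intro E_minus E_scale E_sum) auto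
  have Pne: "P \<noteq> {}" using u[of 0] d by auto
  have "w \<in> zero_hull d P"
  proof (rule ccontr)
    assume "w \<notin> zero_hull d P"
    have z0: "0 \<in> zero_hull d P" using zero_hull_I[OF PE Pne, of "{}"] by simp
    obtain x b where x: "x \<in> E d" "\<forall>y\<in>zero_hull d P. ip d x y \<le> b" "b < ip d x w"
      using separation[OF convex_compact_zero_hull[OF Pc PE Pne] _ wE \<open>w \<notin> zero_hull d P\<close>] z0 by blast
    have b0: "b \<ge> 0" using x(2) z0 by force
    define g where "g = (b + ip d x w) / 2"
    have g: "b < g" "g < ip d x w" "g > 0" using x b0 by (auto simp: g_def)
    \<comment> \<open>After scaling, \<open>x'\<close> is at most \<open>1\<close> on the polars, hence in all sets, and exceeds \<open>1\<close> at \<open>w\<close>.\<close>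
    define x' where "x' = (1 / g) *\<^sub>R x"
    have x'E: "x' \<in> E d" using x by (simp add: x'_def E_scale)
    have "ip d v x' \<le> 1" if v: "v \<in> P" for v
    proof -
      have "v \<in> zero_hull d P" using zero_hull_I[OF PE Pne, of "{0::nat}" "\<lambda>_. v" "\<lambda>_. 1"] v by simp
      then have "ip d x v \<le> g" using x g by force
      then show ?thesis using g by (simp add: x'_def ip_simps ip_commute[of d v])
    qed
    then have "x' \<in> (\<Inter>j\<in>J. A j)" using inX x'E by blast
    then have sx: "- ((1 / d) *\<^sub>R x') \<in> (\<Inter>j\<in>J. A j)" by (rule sym)
    have low: "ip d x' (u i) \<ge> - d" if i: "i < d" for i
    proof -
      obtain j where "j \<in> J" "u i \<in> polar d (A j)" using u[OF i] by (auto simp: P_def)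
      then have "ip d (u i) (- ((1 / d) *\<^sub>R x')) \<le> 1" using sx by (auto simp: polar_def)
      then show ?thesis using d by (simp add: ip_simps ip_commute[of d "u i"] field_simps)
    qed
    have "- (real d * real d) = (\<Sum>i<d. - real d)" by simp
    also have "\<dots> \<le> (\<Sum>i<d. ip d x' (u i))" using low by (intro sum_mono) auto
    finally have "ip d x' w \<le> 1"
      using d by (simp add: w_def ip_simps field_simps power2_eq_square)
    moreover have "ip d x' w > 1" using g by (simp add: x'_def ip_simps)
    ultimately show False by simp
  qed
  then obtain c v where w: "w = (\<Sum>k<d. c k *\<^sub>R v k)"
    and cv: "\<And>k. k < d \<Longrightarrow> 0 \<le> c k" "\<And>k. k < d \<Longrightarrow> v k \<in> P" and c1: "sum c {..<d} \<le> 1"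
    by (auto simp: zero_hull_def)
  have "\<forall>i\<in>{..<d}. \<exists>j. j \<in> J \<and> u i \<in> polar d (A j)" using u by (auto simp: P_def)
  then obtain ju where ju: "\<forall>i\<in>{..<d}. ju i \<in> J \<and> u i \<in> polar d (A (ju i))" by (rule bchoice[elim_format]) blast
  have "\<forall>i\<in>{..<d}. \<exists>j. j \<in> J \<and> v i \<in> polar d (A j)" using cv by (auto simp: P_def)
  then obtain jv where jv: "\<forall>i\<in>{..<d}. jv i \<in> J \<and> v i \<in> polar d (A (jv i))" by (rule bchoice[elim_format]) blast
  define I where "I = ju ` {..<d} \<union> jv ` {..<d}"
  have "card I \<le> card (ju ` {..<d}) + card (jv ` {..<d})" unfolding I_def by (rule card_Un_le)
  also have "\<dots> \<le> d + d" using card_image_le[of "{..<d}" ju] card_image_le[of "{..<d}" jv] by simp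
  finally have card: "card I \<le> 2 * d" by simp
  have "(1 / real (d\<^sup>2 + d)) *\<^sub>R (a - y) \<in> (\<Inter>j\<in>J. A j)" if y: "y \<in> (\<Inter>j\<in>I. A j)" for y
  proof (rule inX)
    have "ju 0 \<in> I" "ju 0 \<in> J" using d ju by (auto simp: I_def)
    then have yE: "y \<in> E d" using y AE by blast
    then show "(1 / real (d\<^sup>2 + d)) *\<^sub>R (a - y) \<in> E d" using a by (intro E_scale E_diff)
    define s where "s i = 1 - ip d (u i) y" for i
    have s0: "s i \<ge> 0" if "i < d" for i
      using y ju that by (auto simp: I_def polar_def s_def)
    have vy: "ip d (v k) y \<le> 1" if "k < d" for k
      using y jv that by (auto simp: I_def polar_def)
    have "ip d w y = (\<Sum>k<d. c k * ip d (v k) y)" by (simp add: w ip_simps)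
    also have "\<dots> \<le> (\<Sum>k<d. c k * 1)" using vy cv by (intro sum_mono mult_left_mono) auto
    also have "\<dots> \<le> 1" using c1 by simp
    finally have "ip d w y \<le> 1" .
    then have "- (\<Sum>i<d. ip d (u i) y) \<le> d\<^sup>2"
      using d by (simp add: w_def ip_simps field_simps)
    then have ssum: "sum s {..<d} \<le> d\<^sup>2 + d" by (simp add: s_def sum_subtractf)
    fix v' assume "v' \<in> P"
    then obtain b where b: "\<forall>i<d. \<bar>b i\<bar> \<le> 1" "v' = (\<Sum>i<d. b i *\<^sub>R u i)" using coords by blast
    have "ip d v' (a - y) = (\<Sum>i<d. b i * s i)"
      using a(2) by (auto simp: b(2) ip_simps s_def ip_commute[of d _ a] algebra_simps sum_subtractf)
    also have "\<dots> \<le> (\<Sum>i<d. 1 * s i)" using b(1) s0 by (intro sum_mono mult_right_mono) (auto simp: abs_le_iff)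
    also have "\<dots> \<le> d\<^sup>2 + d" using ssum by simp
    finally have "ip d v' (a - y) \<le> real (d\<^sup>2 + d)" .
    moreover have "real (d\<^sup>2 + d) > 0" using d by (simp add: add_pos_pos)
    ultimately have "ip d v' (a - y) / real (d\<^sup>2 + d) \<le> 1" by (simp only: divide_le_eq_1_pos)
    then show "ip d v' ((1 / real (d\<^sup>2 + d)) *\<^sub>R (a - y)) \<le> 1"
      by (simp add: ip_scale_right)
  qed
  moreover have "I \<subseteq> J" using ju jv by (auto simp: I_def)
  moreover have "ju 0 \<in> I" using d by (auto simp: I_def)
  then have "I \<noteq> {}" by auto
  ultimately show ?thesis using card a(1) by blast
qed

text \<open>
  The \<open>x\<close> for which the polytope with vertices \<open>- w k\<close>, joined with \<open>0\<close> and translated by \<open>x\<close>, lies in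
  \<open>A\<close>, for convex \<open>A\<close>.
\<close>
definition erosion :: "'k set \<Rightarrow> ('k \<Rightarrow> nat \<Rightarrow> real) \<Rightarrow> (nat \<Rightarrow> real) set \<Rightarrow> (nat \<Rightarrow> real) set" where
  "erosion K w A = {x \<in> A. \<forall>k\<in>K. x - w k \<in> A}"

lemma convex_compact_erosion:
  assumes A: "convex_compact d A" and w: "\<And>k. k \<in> K \<Longrightarrow> w k \<in> E d"
  shows "convex_compact d (erosion K w A)"
proof -
  have "erosion K w A = (\<Inter>z\<in>insert None (Some ` K). case z of None \<Rightarrow> A | Some k \<Rightarrow> {x. - w k + x \<in> A})"
    by (auto simp: erosion_def)
  also have "convex_compact d \<dots>"
    using A convex_compact_translate[OF A E_minus[OF w]] by (intro convex_compact_INT) auto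
  finally show ?thesis .
qed

lemma erosion_INT: "J \<noteq> {} \<Longrightarrow> erosion K w (\<Inter>j\<in>J. A j) = (\<Inter>j\<in>J. erosion K w (A j))"
  by (auto simp: erosion_def)

text \<open>
  It remains to move the origin to a suitable place. That the intersection \<open>X\<close> has interior points follows
  from Helly's theorem for the sets eroded by a small cross-polytope: any \<open>d + 1 \<le> 2 d\<close> of the sets meet
  in volume at least \<open>1\<close>, inside a common cube, and so contain a translate of a cross-polytope of fixed size.
  A center \<open>p\<close> of \<open>X\<close> is then an interior point too, and \<open>quantitative_helly_centered\<close> applies with \<open>p\<close> as
  the origin.
\<close>
theorem quantitative_helly:
  fixes A :: "'j \<Rightarrow> (nat \<Rightarrow> real) set"
  assumes J: "finite J" "J \<noteq> {}" and d: "d \<ge> 1"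
    and cc: "\<And>j. j \<in> J \<Longrightarrow> convex_compact d (A j)"
    and large: "\<And>I. I \<subseteq> J \<Longrightarrow> I \<noteq> {} \<Longrightarrow> card I \<le> 2 * d \<Longrightarrow> 1 \<le> vol d (\<Inter>j\<in>I. A j)"
  shows "1 \<le> real (d\<^sup>2 + d) ^ d * vol d (\<Inter>j\<in>J. A j)"
proof -
  define X where "X = (\<Inter>j\<in>J. A j)"
  have ccX: "convex_compact d X" unfolding X_def using J cc by (intro convex_compact_INT)
  have AE: "A j \<subseteq> E d" if "j \<in> J" for j using cc[OF that] by (simp add: convex_compact_def)
  have "compact (\<Union>j\<in>J. A j)" using J cc by (intro compact_UN) (auto simp: convex_compact_def)
  then obtain T where T: "T \<ge> 0" "(\<Union>j\<in>J. A j) \<subseteq> cube d T"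
    using compact_subset_cube[of "\<Union>j\<in>J. A j" d] AE by blast
  define K where "K = {..<d} \<times> {-1, 1::real}"
  define w where "w k = snd k *\<^sub>R ax (fst k)" for k :: "nat \<times> real"
  have wE: "w k \<in> E d" if "k \<in> K" for k using that by (auto simp: K_def w_def intro!: E_scale ax_in_E)
  have finK: "finite K" by (simp add: K_def)
  obtain m :: nat where m: "card K * vol d (cube d (T + 1)) < m"
    using reals_Archimedean2 by blast
  have "0 \<le> card K * vol d (cube d (T + 1))" by (simp add: vol_nonneg)
  then have m1: "m \<ge> 1" using m by linarith
  define w' where "w' k = (1 / m) *\<^sub>R w k" for k
  have w'E: "w' k \<in> E d" if "k \<in> K" for k using wE[OF that] by (simp add: w'_def E_scale)
  have "(\<Inter>j\<in>J. erosion K w' (A j)) \<noteq> {}"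
  proof (rule helly[where d = d])
    fix j assume "j \<in> J"
    then show "convex (erosion K w' (A j)) \<and> erosion K w' (A j) \<subseteq> E d"
      using convex_compact_erosion[OF cc, of j K w'] w'E unfolding convex_compact_def by blast
  next
    fix I assume I: "I \<subseteq> J" "I \<noteq> {}" "card I \<le> d + 1"
    define Y where "Y = (\<Inter>j\<in>I. A j)"
    have "1 \<le> vol d Y" unfolding Y_def using I d by (intro large) auto
    then have "real m * 1 \<le> real m * vol d Y" by (intro mult_left_mono) auto
    have ccY: "convex_compact d Y" unfolding Y_def using I cc by (intro convex_compact_INT) auto
    have YT: "Y \<subseteq> cube d T" using I T by (auto simp: Y_def)
    have "\<exists>x\<in>Y. \<forall>k\<in>K. x - (1 / m) *\<^sub>R w k \<in> Y"
    proof (rule erosion_nonempty[OF ccY m1 finK wE compact_cube cube_subset_E])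
      fix k x and s :: real assume *: "k \<in> K" "x \<in> Y" "0 \<le> s" "s \<le> 1"
      have x: "x \<in> E d" "\<And>i. i < d \<Longrightarrow> \<bar>x i\<bar> \<le> T" using * YT by (auto simp: cube_def)
      have "\<bar>s * w k i\<bar> \<le> 1" for i
        using * by (auto simp: K_def w_def ax_def abs_mult)
      then have "\<bar>x i + s * w k i\<bar> \<le> T + 1" if "i < d" for i
        using x(2)[OF that] by (smt (verit))
      then show "x + s *\<^sub>R w k \<in> cube d (T + 1)"
        using x wE[OF *(1)] by (simp add: cube_def E_add E_scale)
    qed (use m \<open>real m * 1 \<le> real m * vol d Y\<close> in auto)
    then have "erosion K w' Y \<noteq> {}" by (auto simp: erosion_def w'_def)
    then show "(\<Inter>j\<in>I. erosion K w' (A j)) \<noteq> {}" using I by (simp add: Y_def erosion_INT)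
  qed (use J in auto)
  then obtain q where q: "q \<in> erosion K w' X" using J by (auto simp: X_def erosion_INT)
  obtain p where p: "p \<in> X" "\<And>x. x \<in> X \<Longrightarrow> p - (1 / d) *\<^sub>R (x - p) \<in> X"
    using center_exists[OF ccX _ d] q by (auto simp: erosion_def)
  have pE: "p \<in> E d" using p ccX by (auto simp: convex_compact_def)
  define e where "e = 1 / (m * (real d + 1))"
  have e: "e > 0" using m1 by (simp add: e_def)
  \<comment> \<open>Reflecting and shrinking the cross-polytope around \<open>q\<close> in \<open>p\<close> and mixing the result with \<open>q\<close> gives one centered at \<open>p\<close>.\<close>
  have near: "p + (s * e) *\<^sub>R ax i \<in> X" if i: "i < d" and s: "s \<in> {-1, 1}" for i s
  proof -
    have "q - w' (i, s) \<in> X" using q i s by (auto simp: erosion_def K_def)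
    then have 1: "p - (1 / d) *\<^sub>R (q - w' (i, s) - p) \<in> X" (is "?z \<in> X") by (rule p(2))
    have "(d / (d + 1)) *\<^sub>R ?z + (1 / (d + 1)) *\<^sub>R q \<in> X"
      using ccX 1 q by (intro convexD) (auto simp: convex_compact_def erosion_def field_simps)
    moreover have "(d / (d + 1)) *\<^sub>R ?z + (1 / (d + 1)) *\<^sub>R q = p + (s * e) *\<^sub>R ax i"
      using d m1 by (auto simp: fun_eq_iff w'_def w_def e_def divide_simps add_nonneg_eq_0_iff)
        (auto simp: algebra_simps)
    ultimately show ?thesis by simp
  qed
  define A' where "A' j = {x. p + x \<in> A j}" for j
  have X': "(\<Inter>j\<in>J. A' j) = {x. p + x \<in> X}" by (auto simp: A'_def X_def)
  have "\<exists>I\<subseteq>J. I \<noteq> {} \<and> card I \<le> 2 * d \<and>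
    (\<exists>a\<in>E d. \<forall>y\<in>(\<Inter>j\<in>I. A' j). (1 / real (d\<^sup>2 + d)) *\<^sub>R (a - y) \<in> (\<Inter>j\<in>J. A' j))"
  proof (rule quantitative_helly_centered[OF J d _ e])
    fix j assume "j \<in> J"
    then show "convex_compact d (A' j)" unfolding A'_def using cc pE by (intro convex_compact_translate)
  next
    fix i j assume "i < d" "j \<in> J"
    then show "e *\<^sub>R ax i \<in> A' j \<and> - (e *\<^sub>R ax i) \<in> A' j"
      using near[of i 1] near[of i "-1"] by (auto simp: A'_def X_def)
  next
    fix x assume "x \<in> (\<Inter>j\<in>J. A' j)"
    then show "- ((1 / d) *\<^sub>R x) \<in> (\<Inter>j\<in>J. A' j)"
      unfolding X' using p(2)[of "p + x"] by simp
  qed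
  then obtain I a where I: "I \<subseteq> J" "I \<noteq> {}" "card I \<le> 2 * d" and aE: "a \<in> E d"
    and a: "\<And>y. y \<in> (\<Inter>j\<in>I. A' j) \<Longrightarrow> p + (1 / real (d\<^sup>2 + d)) *\<^sub>R (a - y) \<in> X"
    unfolding X' by blast
  define r where "r = real (d\<^sup>2 + d)"
  have r: "r > 0" using d by (simp add: r_def add_pos_pos)
  let ?h = "\<lambda>x. (p + a + r *\<^sub>R p) + (- r) *\<^sub>R x"
  have sub: "(\<Inter>j\<in>I. A j) \<subseteq> ?h ` X"
  proof
    fix y assume y: "y \<in> (\<Inter>j\<in>I. A j)"
    have "p + (1 / r) *\<^sub>R (a - (y - p)) \<in> X"
      using a[of "y - p"] y by (auto simp: A'_def r_def)
    moreover have "y = ?h (p + (1 / r) *\<^sub>R (a - (y - p)))"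
      using r by (simp add: algebra_simps)
    ultimately show "y \<in> ?h ` X" by blast
  qed
  have hE: "p + a + r *\<^sub>R p \<in> E d" using pE aE by (intro E_add E_scale)
  have cch: "convex_compact d (?h ` X)" by (rule convex_compact_affine[OF ccX hE])
  have "1 \<le> vol d (\<Inter>j\<in>I. A j)" using I by (rule large)
  also have "\<dots> \<le> vol d (?h ` X)"
    using sub cch convex_compact_INT[of I d A] I cc
    by (intro vol_mono) (auto simp: convex_compact_def)
  also have "\<dots> = r ^ d * vol d X"
    using vol_affine[of "- r" "p + a + r *\<^sub>R p" d X] r hE ccX
    by (simp add: convex_compact_def borel_compact)
  finally show ?thesis by (simp add: r_def X_def)
qed

section \<open>The colorful volume theorem\<close>

lemma convex_simplex_mem:
  assumes M: "convex M" "x0 \<in> M" "\<And>k. k < d \<Longrightarrow> x0 + w k \<in> M"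
    and c: "\<And>k. k < (d::nat) \<Longrightarrow> 0 \<le> c k" "sum c {..<d} \<le> 1"
  shows "x0 + (\<Sum>k<d. c k *\<^sub>R w k) \<in> M"
proof -
  define b where "b k = (if k < d then c k else 1 - sum c {..<d})" for k
  define y where "y k = (if k < d then x0 + w k else x0)" for k
  have "(\<Sum>k<Suc d. b k *\<^sub>R y k) \<in> M"
  proof (rule convex_sum)
    show "sum b {..<Suc d} = 1" by (simp add: b_def)
  qed (use M c in \<open>auto simp: b_def y_def\<close>)
  also have "(\<Sum>k<Suc d. b k *\<^sub>R y k) = (\<Sum>k<d. c k *\<^sub>R (x0 + w k)) + (1 - sum c {..<d}) *\<^sub>R x0"
    by (simp add: b_def y_def)
  also have "\<dots> = x0 + (\<Sum>k<d. c k *\<^sub>R w k)"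
    by (simp add: scaleR_add_right sum.distrib scaleR_diff_left scaleR_left.sum)
  finally show ?thesis .
qed

text \<open>
  A body of positive volume contains a point \<open>x0\<close> together with the points
  \<open>x0 - ax i / m\<close>, for some \<open>m\<close>, by \<open>erosion_nonempty\<close>. So the
  differences with \<open>x0\<close> span the space, and \<open>bounded_coordinates_basis\<close> applies to them. The simplex with
  vertices \<open>x0\<close> and \<open>x0 + w i\<close> is inside \<open>M\<close>, and the parallelepiped that is centered at \<open>x0\<close> and spanned
  by the \<open>w i\<close> is around it.
\<close>
lemma inscribed_frame:
  assumes M: "convex_compact d M" and pos: "vol d M > 0" and d: "d \<ge> 1"
  shows "\<exists>x0\<in>M. \<exists>w. (\<forall>i<d. w i \<in> E d \<and> x0 + w i \<in> M) \<and>
    (\<forall>y\<in>M. \<exists>a. (\<forall>i<d. \<bar>a i\<bar> \<le> 1) \<and> y = x0 + (\<Sum>i<d. a i *\<^sub>R w i))"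
proof -
  have ME: "M \<subseteq> E d" and Mc: "compact M" using M by (auto simp: convex_compact_def)
  obtain T where T: "T \<ge> 0" "M \<subseteq> cube d T" using compact_subset_cube[OF Mc ME] by auto
  obtain m :: nat where m: "d * vol d (cube d (T + 1)) / vol d M < m"
    using reals_Archimedean2 by blast
  have "0 \<le> d * vol d (cube d (T + 1)) / vol d M" by (simp add: vol_nonneg)
  then have m1: "m \<ge> 1" using m by linarith
  have "\<exists>x\<in>M. \<forall>k\<in>{..<d}. x - (1 / m) *\<^sub>R ax k \<in> M"
  proof (rule erosion_nonempty[OF M m1 _ _ compact_cube cube_subset_E])
    fix k x and s :: real assume *: "k \<in> {..<d}" "x \<in> M" "0 \<le> s" "s \<le> 1"
    have x: "x \<in> E d" "\<And>i. i < d \<Longrightarrow> \<bar>x i\<bar> \<le> T" using * T by (auto simp: cube_def)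
    have "\<bar>x i + s * ax k i\<bar> \<le> T + 1" if "i < d" for i
      using x(2)[OF that] * by (auto simp: ax_def)
    then show "x + s *\<^sub>R ax k \<in> cube d (T + 1)"
      using x ax_in_E[of k d] * by (simp add: cube_def E_add E_scale)
  next
    show "card {..<d} * vol d (cube d (T + 1)) < m * vol d M"
      using m pos by (simp add: field_simps)
  qed (auto intro: ax_in_E)
  then obtain x0 where x0: "x0 \<in> M" "\<And>k. k < d \<Longrightarrow> x0 - (1 / m) *\<^sub>R ax k \<in> M" by auto
  have x0E: "x0 \<in> E d" using x0 ME by auto
  define P where "P = {z. x0 + z \<in> M}"
  have P: "compact P" "P \<subseteq> E d"
    using convex_compact_translate[OF M x0E] by (auto simp: P_def convex_compact_def)
  have "- (1 / m) \<noteq> 0" using m1 by simp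
  moreover have "- (1 / m) *\<^sub>R ax i \<in> P" if "i < d" for i
    using x0(2)[OF that] by (simp add: P_def)
  ultimately obtain w where w: "\<forall>i<d. w i \<in> P"
    "\<forall>v\<in>P. \<exists>a. (\<forall>i<d. \<bar>a i\<bar> \<le> 1) \<and> v = (\<Sum>i<d. a i *\<^sub>R w i)"
    using bounded_coordinates_basis[OF P _ _ d] by blast
  have "\<exists>a. (\<forall>i<d. \<bar>a i\<bar> \<le> 1) \<and> y = x0 + (\<Sum>i<d. a i *\<^sub>R w i)" if "y \<in> M" for y
  proof -
    have "y - x0 \<in> P" using that by (simp add: P_def)
    then obtain a where "\<forall>i<d. \<bar>a i\<bar> \<le> 1" "y - x0 = (\<Sum>i<d. a i *\<^sub>R w i)" using w(2) by blast
    then show ?thesis by (intro exI[of _ a]) (simp add: algebra_simps)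
  qed
  then show ?thesis using x0(1) w(1) P by (intro bexI[of _ x0] exI[of _ w]) (auto simp: P_def)
qed

text \<open>
  For \<open>k\<close> in \<open>{..<d} \<times> {-1, 1}\<close> these are the vertices of the cross-polytope with semi-axes \<open>w i / m\<close>.
\<close>
definition cross_vertex :: "nat \<Rightarrow> (nat \<Rightarrow> nat \<Rightarrow> real) \<Rightarrow> nat \<times> real \<Rightarrow> nat \<Rightarrow> real" where
  "cross_vertex m w k = (snd k / m) *\<^sub>R w (fst k)"

text \<open>
  Translating \<open>X\<close> along a vector \<open>\<plusminus> w i\<close> stays inside the parallelepiped \<open>x0 + \<Sum>[-2, 2] w i\<close>. A homothet
  of \<open>M\<close> with ratio \<open>4 d\<close> covers it, since a parallelepiped with coefficients in \<open>[0, 1 / d]\<close>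
  fits into the simplex inscribed in \<open>M\<close>. Hence each of the \<open>2 d\<close> translations loses at most
  the volume \<open>(4 d)\<^sup>d vol M / m\<close> of \<open>X\<close>.
\<close>
lemma erosion_of_large_subset:
  fixes m d :: nat
  assumes M: "convex_compact d M" and x0: "x0 \<in> M" and d: "d \<ge> 1"
    and w: "\<And>i. i < d \<Longrightarrow> w i \<in> E d" "\<And>i. i < d \<Longrightarrow> x0 + w i \<in> M"
    and coords: "\<And>y. y \<in> M \<Longrightarrow> \<exists>a. (\<forall>i<d. \<bar>a i\<bar> \<le> 1) \<and> y = x0 + (\<Sum>i<d. a i *\<^sub>R w i)"
    and X: "convex_compact d X" "X \<subseteq> M"
    and large: "2 * d * (4 * d) ^ d * vol d M < m * vol d X"
  shows "erosion ({..<d} \<times> {-1, 1}) (cross_vertex m w) X \<noteq> {}"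
proof -
  let ?K = "{..<d} \<times> {-1, 1::real}"
  have ME: "M \<subseteq> E d" and Mc: "compact M" using M by (auto simp: convex_compact_def)
  have "0 \<le> 2 * d * (4 * d) ^ d * vol d M" by (simp add: vol_nonneg)
  then have m1: "m \<ge> 1" using large by (cases "m = 0") auto
  define a where "a = x0 - 2 *\<^sub>R (\<Sum>i<d. w i) - (4 * d) *\<^sub>R x0"
  have aE: "a \<in> E d" unfolding a_def using x0 ME w by (intro E_diff E_scale E_sum) auto
  define B where "B = (\<lambda>z. a + (4 * d) *\<^sub>R z) ` M"
  have ccB: "convex_compact d B" unfolding B_def by (rule convex_compact_affine[OF M aE])
  have volB: "vol d B = (4 * d) ^ d * vol d M"
    unfolding B_def using vol_affine[of "4 * d" a d M] d aE Mc by (simp add: borel_compact)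
  have inB: "x0 + (\<Sum>j<d. b j *\<^sub>R w j) \<in> B" if b: "\<And>j. j < d \<Longrightarrow> \<bar>b j\<bar> \<le> 2" for b
  proof -
    define c where "c j = (b j + 2) / (4 * d)" for j
    have c: "0 \<le> c j" "c j \<le> 1 / d" if "j < d" for j
      using b[OF that] d by (auto simp: c_def field_simps abs_le_iff)
    have "sum c {..<d} \<le> (\<Sum>j<d. 1 / d)" using c by (intro sum_mono) auto
    then have "sum c {..<d} \<le> 1" using d by simp
    then have z: "x0 + (\<Sum>j<d. c j *\<^sub>R w j) \<in> M"
      using M x0 w c by (intro convex_simplex_mem) (auto simp: convex_compact_def)
    have "(4 * d) *\<^sub>R (\<Sum>j<d. c j *\<^sub>R w j) = (\<Sum>j<d. (b j + 2) *\<^sub>R w j)"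
      unfolding scaleR_right.sum by (intro sum.cong) (use d in \<open>auto simp: c_def\<close>)
    also have "\<dots> = (\<Sum>j<d. b j *\<^sub>R w j) + 2 *\<^sub>R (\<Sum>j<d. w j)"
      by (simp add: scaleR_add_left sum.distrib scaleR_right.sum)
    finally have "x0 + (\<Sum>j<d. b j *\<^sub>R w j) = a + (4 * d) *\<^sub>R (x0 + (\<Sum>j<d. c j *\<^sub>R w j))"
      unfolding a_def scaleR_add_right by simp
    then show ?thesis unfolding B_def using z by blast
  qed
  have "\<exists>x\<in>X. \<forall>k\<in>?K. x - (1 / m) *\<^sub>R (snd k *\<^sub>R w (fst k)) \<in> X"
  proof (rule erosion_nonempty[OF X(1) m1, where B = B])
    show "compact B" "B \<subseteq> E d" using ccB by (auto simp: convex_compact_def)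
    show "card ?K * vol d B < m * vol d X" using large volB by (simp add: card_cartesian_product)
    fix k x and s :: real assume *: "k \<in> ?K" "x \<in> X" "0 \<le> s" "s \<le> 1"
    obtain b where b: "\<forall>i<d. \<bar>b i\<bar> \<le> 1" "x = x0 + (\<Sum>i<d. b i *\<^sub>R w i)"
      using coords * X by blast
    define i where "i = fst k"
    have i: "i < d" "\<bar>s * snd k\<bar> \<le> 1" using * by (auto simp: i_def)
    define b' where "b' j = b j + (if j = i then s * snd k else 0)" for j
    have "x0 + (\<Sum>j<d. b' j *\<^sub>R w j) \<in> B"
    proof (rule inB)
      fix j assume "j < d"
      then have "\<bar>b j\<bar> \<le> 1" using b by auto
      then show "\<bar>b' j\<bar> \<le> 2" using i(2) by (auto simp: b'_def)
    qed
    moreover have "(\<Sum>j<d. b' j *\<^sub>R w j) = (\<Sum>j<d. b j *\<^sub>R w j) + (\<Sum>j<d. if j = i then (s * snd k) *\<^sub>R w j else 0)"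
      unfolding sum.distrib[symmetric] by (intro sum.cong) (auto simp: b'_def scaleR_add_left)
    moreover have "(\<Sum>j<d. if j = i then (s * snd k) *\<^sub>R w j else 0) = (s * snd k) *\<^sub>R w i"
      using i by simp
    ultimately show "x + s *\<^sub>R (snd k *\<^sub>R w (fst k)) \<in> B"
      by (simp add: b(2) i_def add.assoc)
  qed (use w in \<open>auto intro!: E_scale\<close>)
  then show ?thesis by (auto simp: erosion_def cross_vertex_def)
qed

text \<open>
  Each \<open>y - x0\<close> with \<open>y\<close> in \<open>M\<close> has coordinates in \<open>[-1, 1]\<close> with respect to the \<open>w i\<close>; after division by
  \<open>d\<close> their absolute values add up to at most \<open>1\<close>, so the vector is in the cross-polytope spanned by
  the \<open>\<plusminus> w i\<close>.
\<close>
lemma homothet_in_eroded: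
  fixes m d :: nat
  assumes C: "convex C" and d: "d \<ge> 1" and m: "m \<ge> 1"
    and coords: "\<And>y. y \<in> M \<Longrightarrow> \<exists>a. (\<forall>i<d. \<bar>a i\<bar> \<le> 1) \<and> y = x0 + (\<Sum>i<d. a i *\<^sub>R w i)"
    and x: "x \<in> erosion ({..<d} \<times> {-1, 1}) (cross_vertex m w) C"
  shows "(\<lambda>y. (x - (1 / (m * d)) *\<^sub>R x0) + (1 / (m * d)) *\<^sub>R y) ` M \<subseteq> C"
proof
  fix z assume "z \<in> (\<lambda>y. (x - (1 / (m * d)) *\<^sub>R x0) + (1 / (m * d)) *\<^sub>R y) ` M"
  then obtain y where y: "y \<in> M" "z = (x - (1 / (m * d)) *\<^sub>R x0) + (1 / (m * d)) *\<^sub>R y" by auto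
  obtain a where a: "\<forall>i<d. \<bar>a i\<bar> \<le> 1" "y = x0 + (\<Sum>i<d. a i *\<^sub>R w i)" using coords[OF y(1)] by auto
  define s where "s i = (if a i \<ge> 0 then 1 else -1 :: real)" for i
  define v where "v i = - cross_vertex m w (i, - s i)" for i
  define c where "c i = \<bar>a i\<bar> / d" for i
  have "x + (\<Sum>i<d. c i *\<^sub>R v i) \<in> C"
  proof (rule convex_simplex_mem[OF C])
    show "x \<in> C" using x by (simp add: erosion_def)
    show "x + v i \<in> C" if "i < d" for i
    proof -
      have "(i, - s i) \<in> {..<d} \<times> {-1, 1}" using that by (simp add: s_def)
      then show ?thesis using x by (auto simp: erosion_def v_def)
    qed
    have "sum c {..<d} \<le> (\<Sum>i<d. 1 / d)" unfolding c_def using a by (intro sum_mono divide_right_mono) auto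
    then show "sum c {..<d} \<le> 1" using d by simp
  qed (simp add: c_def)
  moreover have "(\<Sum>i<d. c i *\<^sub>R v i) = (1 / (m * d)) *\<^sub>R (\<Sum>i<d. a i *\<^sub>R w i)"
    unfolding scaleR_right.sum
    by (intro sum.cong) (auto simp: c_def v_def s_def cross_vertex_def fun_eq_iff)
  ultimately show "z \<in> C" by (simp add: y(2) a(2) scaleR_add_right)
qed

lemma superset_with_card:
  assumes "finite N" "I \<subseteq> N" "card I \<le> n" "n \<le> card N"
  shows "\<exists>I'. I \<subseteq> I' \<and> I' \<subseteq> N \<and> card I' = n"
proof -
  have finI: "finite I" using assms finite_subset by auto
  have "n - card I \<le> card (N - I)" using assms finI by (simp add: card_Diff_subset)
  then obtain D where D: "D \<subseteq> N - I" "card D = n - card I" by (meson obtain_subset_with_card_n)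
  have "card (I \<union> D) = n"
    using D assms finI by (subst card_Un_disjoint) (auto intro: finite_subset)
  then show ?thesis using D assms by (intro exI[of _ "I \<union> D"]) auto
qed

text \<open>
  The extremal choice \<open>s\<close> of \<open>2 d - 1\<close> colors and bodies leaves \<open>d + 1\<close> colors. For one body of each of
  these, \<open>quantitative_helly\<close> shows that the intersection is not small compared with \<open>M\<close>, so the bodies eroded by the
  cross-polytope of size \<open>1 / m\<close> meet. Then \<open>colorful_helly\<close> gives one color whose eroded bodies all meet,
  and a common point is the place of a homothet of \<open>M\<close> in the intersection of that family.
\<close>
theorem colorful_volume:
  fixes \<F> :: "nat \<Rightarrow> (nat \<Rightarrow> real) set set" and m d :: nat
  assumes d: "d \<ge> 1" and N: "finite N" "card N = 3 * d"
    and fam: "\<And>i. i \<in> N \<Longrightarrow> finite (\<F> i) \<and> \<F> i \<noteq> {}"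
    and cc: "\<And>i C. i \<in> N \<Longrightarrow> C \<in> \<F> i \<Longrightarrow> convex_compact d C"
    and large: "\<And>I f. I \<subseteq> N \<Longrightarrow> card I = 2 * d \<Longrightarrow> (\<And>i. i \<in> I \<Longrightarrow> f i \<in> \<F> i) \<Longrightarrow>
      1 \<le> vol d (\<Inter>i\<in>I. f i)"
    and m: "2 * d * (4 * d) ^ d * (d\<^sup>2 + d) ^ d < m"
  shows "\<exists>i\<in>N. (1 / (m * d)) ^ d \<le> vol d (\<Inter>(\<F> i))"
proof -
  define Sel where "Sel = (SIGMA I:{I. I \<subseteq> N \<and> card I = 2 * d - 1}. PiE I \<F>)"
  define P where "P s = (\<Inter>k\<in>fst s. snd s k)" for s :: "nat set \<times> (nat \<Rightarrow> (nat \<Rightarrow> real) set)"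
  define h0 where "h0 i = (SOME C. C \<in> \<F> i)" for i
  have h0: "h0 i \<in> \<F> i" if "i \<in> N" for i
    unfolding h0_def using fam[OF that] by (intro some_in_eq[THEN iffD2]) simp
  have finSel: "finite Sel" unfolding Sel_def
  proof (rule finite_SigmaI)
    show "finite {I. I \<subseteq> N \<and> card I = 2 * d - 1}" using N by simp
    show "finite (PiE I \<F>)" if "I \<in> {I. I \<subseteq> N \<and> card I = 2 * d - 1}" for I
      using that N fam by (intro finite_PiE) (auto intro: finite_subset)
  qed
  have cardN: "2 * d - 1 \<le> card N" "2 * d \<le> card N" using N by linarith+
  obtain I0 where "I0 \<subseteq> N" "card I0 = 2 * d - 1"
    using superset_with_card[OF N(1) empty_subsetI _ cardN(1)] by auto
  then have "(I0, restrict h0 I0) \<in> Sel" using h0 by (auto simp: Sel_def)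
  then have neSel: "Sel \<noteq> {}" by auto
  have ccP: "convex_compact d (P s)" if s: "s \<in> Sel" for s
  proof -
    have "fst s \<noteq> {}" using s d by (auto simp: Sel_def)
    then show ?thesis unfolding P_def using s cc by (intro convex_compact_INT) (auto simp: Sel_def PiE_iff)
  qed
  have volP: "1 \<le> vol d (P s)" if s: "s \<in> Sel" for s
  proof -
    obtain I f where If: "s = (I, f)" "I \<subseteq> N" "card I = 2 * d - 1" "f \<in> PiE I \<F>"
      using s by (auto simp: Sel_def)
    obtain I1 where I1: "I \<subseteq> I1" "I1 \<subseteq> N" "card I1 = 2 * d"
      using superset_with_card[OF N(1) If(2) _ cardN(2)] If(3) by auto
    define f1 where "f1 i = (if i \<in> I then f i else h0 i)" for i
    have f1: "f1 i \<in> \<F> i" if "i \<in> I1" for i using that I1 h0 If by (auto simp: f1_def PiE_iff)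
    have "1 \<le> vol d (\<Inter>i\<in>I1. f1 i)" using I1 f1 by (intro large)
    also have "\<dots> \<le> vol d (P s)"
    proof (rule vol_mono)
      have "I1 \<noteq> {}" using I1 d by auto
      then have "convex_compact d (\<Inter>i\<in>I1. f1 i)"
        using f1 I1 cc by (intro convex_compact_INT) auto
      then show "compact (\<Inter>i\<in>I1. f1 i)" by (simp add: convex_compact_def)
      show "(\<Inter>i\<in>I1. f1 i) \<subseteq> P s"
        unfolding P_def If(1) fst_conv snd_conv
      proof (rule INT_greatest)
        fix k assume "k \<in> I"
        then have "k \<in> I1" "f1 k = f k" using I1 by (auto simp: f1_def)
        then show "(\<Inter>i\<in>I1. f1 i) \<subseteq> f k" by blast
      qed
    qed (use ccP[OF s] in \<open>auto simp: convex_compact_def\<close>)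
    finally show ?thesis .
  qed
  define t where "t s = (SOME t. 0 \<le> t \<and> vol d (P s \<inter> cube d t) = 1)" for s
  have t: "0 \<le> t s \<and> vol d (P s \<inter> cube d (t s)) = 1" if s: "s \<in> Sel" for s
  proof -
    have "\<exists>t\<ge>0. vol d (P s \<inter> cube d t) = 1"
      using ccP[OF s] volP[OF s] d unfolding convex_compact_def by (intro vol_cube_cut) auto
    then show ?thesis unfolding t_def by (rule someI_ex)
  qed
  obtain s where s: "s \<in> Sel" and max: "\<And>s'. s' \<in> Sel \<Longrightarrow> t s' \<le> t s"
  proof -
    have "Max (t ` Sel) \<in> t ` Sel" using finSel neSel by (intro Max_in) auto
    then obtain s where "s \<in> Sel" "t s = Max (t ` Sel)" by auto
    then show ?thesis using finSel by (intro that[of s]) auto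
  qed
  obtain I f where If: "s = (I, f)" "I \<subseteq> N" "card I = 2 * d - 1" "f \<in> PiE I \<F>"
    using s by (auto simp: Sel_def)
  define Q where "Q = cube d (t s)"
  define M where "M = P s \<inter> Q"
  have ccM: "convex_compact d M"
    unfolding M_def Q_def by (intro convex_compact_Int ccP s convex_compact_cube)
  have volM: "vol d M = 1" using t[OF s] by (simp add: M_def Q_def)
  obtain x0 w where x0: "x0 \<in> M" and w: "\<And>i. i < d \<Longrightarrow> w i \<in> E d" "\<And>i. i < d \<Longrightarrow> x0 + w i \<in> M"
    and coords: "\<And>y. y \<in> M \<Longrightarrow> \<exists>a. (\<forall>i<d. \<bar>a i\<bar> \<le> 1) \<and> y = x0 + (\<Sum>i<d. a i *\<^sub>R w i)"
  proof -
    have "vol d M > 0" using volM by simp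
    from inscribed_frame[OF ccM this d] show ?thesis using that by blast
  qed
  define er where "er = erosion ({..<d} \<times> {-1, 1}) (cross_vertex m w)"
  have m1: "m \<ge> 1" using m by linarith
  have cc_er: "convex_compact d (er C)" if "convex_compact d C" for C
    unfolding er_def using that w by (intro convex_compact_erosion) (auto simp: cross_vertex_def intro: E_scale)
  have rainbow: "(\<Inter>i\<in>N - I. er (g i)) \<noteq> {}" if g: "\<And>i. i \<in> N - I \<Longrightarrow> g i \<in> \<F> i" for g
  proof -
    define h where "h i = (if i \<in> I then f i else g i)" for i
    have h: "h i \<in> \<F> i" if "i \<in> N" for i using that g If by (auto simp: h_def PiE_iff)
    \<comment> \<open>The \<open>3 d + 1\<close> sets: the cube has the index \<open>None\<close>.\<close>
    define A where "A = (\<lambda>z. case z of None \<Rightarrow> Q | Some i \<Rightarrow> h i)"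
    define J where "J = insert None (Some ` N)"
    have ccA: "convex_compact d (A z)" if "z \<in> J" for z
      using that cc[OF _ h] by (auto simp: A_def J_def Q_def convex_compact_cube)
    have "1 \<le> real (d\<^sup>2 + d) ^ d * vol d (\<Inter>z\<in>J. A z)"
    proof (rule quantitative_helly[OF _ _ d ccA])
      show "finite J" "J \<noteq> {}" using N by (auto simp: J_def)
      fix I' assume I': "I' \<subseteq> J" "I' \<noteq> {}" "card I' \<le> 2 * d"
      define I0 where "I0 = {i. Some i \<in> I'}"
      have I0: "I0 \<subseteq> N" using I' by (auto simp: I0_def J_def)
      have finI': "finite I'" using I' N finite_subset[of I' J] by (auto simp: J_def)
      have ccI': "convex_compact d (\<Inter>z\<in>I'. A z)"
        using I' ccA by (intro convex_compact_INT) auto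
      have Some_I0: "card I0 = card (Some ` I0)" by (simp add: card_image)
      show "1 \<le> vol d (\<Inter>z\<in>I'. A z)"
      proof (cases "None \<in> I'")
        case True
        have "Some ` I0 \<subseteq> I' - {None}" by (auto simp: I0_def)
        then have "card I0 \<le> card (I' - {None})"
          unfolding Some_I0 using finI' by (intro card_mono) auto
        also have "\<dots> \<le> 2 * d - 1" using I' True finI' by simp
        finally obtain I1 where I1: "I0 \<subseteq> I1" "I1 \<subseteq> N" "card I1 = 2 * d - 1"
          using superset_with_card[OF N(1) I0 _ cardN(1)] by blast
        \<comment> \<open>The cube of \<open>s1\<close> is contained in \<open>Q\<close> by the choice of \<open>s\<close>.\<close>
        define s1 where "s1 = (I1, restrict h I1)"
        have s1: "s1 \<in> Sel" using I1 h by (auto simp: s1_def Sel_def)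
        have "vol d (P s1 \<inter> cube d (t s1)) \<le> vol d (\<Inter>z\<in>I'. A z)"
        proof (rule vol_mono)
          have cub: "cube d (t s1) \<subseteq> Q" using max[OF s1] by (force simp: Q_def cube_def)
          show "P s1 \<inter> cube d (t s1) \<subseteq> (\<Inter>z\<in>I'. A z)"
          proof (intro subsetI INT_I)
            fix x z assume x: "x \<in> P s1 \<inter> cube d (t s1)" and z: "z \<in> I'"
            show "x \<in> A z"
            proof (cases z)
              case None then show ?thesis using x cub by (auto simp: A_def)
            next
              case (Some i)
              then have "i \<in> I1" using z I1 by (auto simp: I0_def)
              then show ?thesis using x Some by (auto simp: A_def P_def s1_def)
            qed
          qed
          show "compact (P s1 \<inter> cube d (t s1))"
            using ccP[OF s1] compact_cube by (auto simp: convex_compact_def intro: compact_Int)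
        qed (use ccI' in \<open>auto simp: convex_compact_def\<close>)
        then show ?thesis using t[OF s1] by simp
      next
        case False
        have "Some ` I0 \<subseteq> I'" by (auto simp: I0_def)
        then have "card I0 \<le> 2 * d"
          unfolding Some_I0 by (rule order_trans[OF card_mono[OF finI'] I'(3)])
        then obtain I1 where I1: "I0 \<subseteq> I1" "I1 \<subseteq> N" "card I1 = 2 * d"
          using superset_with_card[OF N(1) I0 _ cardN(2)] by blast
        have "1 \<le> vol d (\<Inter>i\<in>I1. h i)" using I1 h by (intro large) auto
        also have "\<dots> \<le> vol d (\<Inter>z\<in>I'. A z)"
        proof (rule vol_mono)
          show "(\<Inter>i\<in>I1. h i) \<subseteq> (\<Inter>z\<in>I'. A z)"
          proof (intro subsetI INT_I)
            fix x z assume x: "x \<in> (\<Inter>i\<in>I1. h i)" and z: "z \<in> I'"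
            obtain i where "z = Some i" using z False by (cases z) auto
            moreover from this have "i \<in> I1" using z I1 by (auto simp: I0_def)
            ultimately show "x \<in> A z" using x by (auto simp: A_def)
          qed
          have "I1 \<noteq> {}" using I1 d by auto
          then have "convex_compact d (\<Inter>i\<in>I1. h i)"
            using cc[OF _ h] I1 by (intro convex_compact_INT) auto
          then show "compact (\<Inter>i\<in>I1. h i)" by (simp add: convex_compact_def)
        qed (use ccI' in \<open>auto simp: convex_compact_def\<close>)
        finally show ?thesis .
      qed
    qed
    define X where "X = (\<Inter>z\<in>J. A z)"
    have ccX: "convex_compact d X" unfolding X_def using ccA by (intro convex_compact_INT) (auto simp: J_def)
    have XM: "X \<subseteq> M"
    proof
      fix x assume x: "x \<in> X"
      have "x \<in> A None" using x by (auto simp: X_def J_def)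
      moreover have "x \<in> f i" if "i \<in> I" for i
      proof -
        have "x \<in> A (Some i)" using x that If by (auto simp: X_def J_def)
        then show ?thesis using that by (simp add: A_def h_def)
      qed
      ultimately show "x \<in> M" by (auto simp: M_def A_def P_def If)
    qed
    have "er X \<noteq> {}" unfolding er_def
    proof (rule erosion_of_large_subset[OF ccM x0 d w coords ccX XM])
      let ?D = "real (d\<^sup>2 + d) ^ d"
      have D: "?D > 0" using d by (simp add: add_pos_pos)
      have "1 / ?D \<le> vol d X"
        using \<open>1 \<le> real (d\<^sup>2 + d) ^ d * vol d (\<Inter>z\<in>J. A z)\<close> D by (simp add: X_def field_simps)
      then have "real m * (1 / ?D) \<le> real m * vol d X" by (intro mult_left_mono) auto
      moreover have "real (2 * d * (4 * d) ^ d) < real m * (1 / ?D)"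
      proof -
        have "real (2 * d * (4 * d) ^ d) * ?D < real m"
          using m by (metis of_nat_less_iff of_nat_mult of_nat_power)
        then show ?thesis using D by (simp only: pos_less_divide_eq mult_1_right times_divide_eq_right)
      qed
      ultimately show "2 * d * (4 * d) ^ d * vol d M < m * vol d X" by (simp add: volM)
    qed
    then obtain x where x: "x \<in> er X" by auto
    have "x \<in> er (g i)" if i: "i \<in> N - I" for i
    proof -
      have "X \<subseteq> A (Some i)" using i by (auto simp: X_def J_def)
      then have "X \<subseteq> g i" using i by (simp add: A_def h_def)
      then show ?thesis using x by (auto simp: er_def erosion_def)
    qed
    then show ?thesis by blast
  qed
  have "\<exists>i\<in>N - I. \<Inter>(er ` \<F> i) \<noteq> {}"
  proof (rule colorful_helly[OF _ _ d])
    show "finite (N - I)" using N by simp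
    have "finite I" using If N finite_subset by auto
    then show "card (N - I) = d + 1" using N If d by (simp add: card_Diff_subset)
    show "finite (er ` \<F> i) \<and> er ` \<F> i \<noteq> {}" if "i \<in> N - I" for i using that fam by simp
    show "convex_compact d C" if "i \<in> N - I" "C \<in> er ` \<F> i" for i C using that cc cc_er by auto
    fix G assume G: "\<And>i. i \<in> N - I \<Longrightarrow> G i \<in> er ` \<F> i"
    then have "\<forall>i\<in>N - I. \<exists>C. C \<in> \<F> i \<and> G i = er C" by blast
    then obtain g where "\<forall>i\<in>N - I. g i \<in> \<F> i \<and> G i = er (g i)" by (rule bchoice[elim_format]) blast
    then show "(\<Inter>i\<in>N - I. G i) \<noteq> {}" using rainbow[of g] by auto
  qed
  then obtain i x where i: "i \<in> N" and x: "\<And>C. C \<in> \<F> i \<Longrightarrow> x \<in> er C" by blast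
  define r where "r = 1 / (real m * real d)"
  have r: "r > 0" using m1 d by (simp add: r_def)
  obtain C0 where C0: "C0 \<in> \<F> i" using fam[OF i] by auto
  have "x \<in> C0" using x[OF C0] by (simp add: er_def erosion_def)
  then have xE: "x \<in> E d" using cc[OF i C0] by (auto simp: convex_compact_def)
  have x0E: "x0 \<in> E d" using x0 ccM by (auto simp: convex_compact_def)
  have aE: "x - r *\<^sub>R x0 \<in> E d" using xE x0E by (intro E_diff E_scale)
  have "(\<lambda>y. (x - r *\<^sub>R x0) + r *\<^sub>R y) ` M \<subseteq> C" if C: "C \<in> \<F> i" for C
    using homothet_in_eroded[of C d m M x0 w x] cc[OF i C] d m1 coords x[OF C]
    by (simp add: r_def er_def convex_compact_def)
  then have sub: "(\<lambda>y. (x - r *\<^sub>R x0) + r *\<^sub>R y) ` M \<subseteq> \<Inter>(\<F> i)" by blast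
  have ccF: "convex_compact d (\<Inter>(\<F> i))"
    using convex_compact_INT[of "\<F> i" d id] fam[OF i] cc[OF i] by simp
  have "r ^ d = vol d ((\<lambda>y. (x - r *\<^sub>R x0) + r *\<^sub>R y) ` M)"
    using vol_affine[of r "x - r *\<^sub>R x0" d M] r aE ccM volM by (simp add: convex_compact_def borel_compact)
  also have "\<dots> \<le> vol d (\<Inter>(\<F> i))"
    using sub ccF convex_compact_affine[OF ccM aE, of r] by (intro vol_mono) (auto simp: convex_compact_def)
  finally show ?thesis using i by (auto simp: r_def)
qed

section \<open>Transfer to extensional functions\<close>

lemma inj_on_zext: "inj_on (zext d) (R_space d)"
proof (rule inj_onI)
  fix x y assume *: "x \<in> R_space d" "y \<in> R_space d" "zext d x = zext d y"
  show "x = y"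
  proof (rule extensionalityI[of _ "{..<d}"])
    show "x i = y i" if "i \<in> {..<d}" for i
      using fun_cong[OF *(3), of i] that by (simp add: zext_def)
  qed (use * in \<open>auto simp: R_space_def PiE_iff\<close>)
qed

lemma convex_body_zext:
  assumes "convex_body d K"
  shows "K \<subseteq> R_space d" and "convex_compact d (zext d ` K)"
proof -
  have K: "compactin (R_top d) K" "R_convex d K" using assms by (auto simp: convex_body_def)
  show KR: "K \<subseteq> R_space d" using compactin_subset_topspace[OF K(1)] by (simp add: topspace_R_top)
  have "continuous_map (R_top d) (product_topology (\<lambda>_. euclideanreal) UNIV) (zext d)"
    unfolding continuous_map_componentwise_UNIV
  proof
    fix i show "continuous_map (R_top d) euclideanreal (\<lambda>x. zext d x i)"
      by (cases "i < d") (auto simp: zext_def R_top_def intro: continuous_map_product_projection)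
  qed
  then have "compactin euclidean (zext d ` K)"
    using image_compactin[OF K(1)] unfolding euclidean_product_topology by blast
  then have "compact (zext d ` K)" by simp
  moreover have "convex (zext d ` K)"
  proof (rule convexI)
    fix x y and u v :: real
    assume *: "x \<in> zext d ` K" "y \<in> zext d ` K" "0 \<le> u" "0 \<le> v" "u + v = 1"
    then obtain a b where ab: "a \<in> K" "b \<in> K" "x = zext d a" "y = zext d b" by auto
    have "(\<lambda>i\<in>{..<d}. u * a i + v * b i) \<in> K" using K(2) ab * by (auto simp: R_convex_def)
    moreover have "u *\<^sub>R x + v *\<^sub>R y = zext d (\<lambda>i\<in>{..<d}. u * a i + v * b i)"
      by (auto simp: ab zext_def fun_eq_iff)
    ultimately show "u *\<^sub>R x + v *\<^sub>R y \<in> zext d ` K" by blast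
  qed
  ultimately show "convex_compact d (zext d ` K)"
    using zext_in_E by (auto simp: convex_compact_def)
qed

lemma R_vol_zext:
  assumes "A \<subseteq> R_space d" "convex_compact d (zext d ` A)"
  shows "R_vol d A = ennreal (vol d (zext d ` A))"
proof -
  have "zext d -` zext d ` A \<inter> R_space d = A"
    using inj_on_zext[of d] assms(1) by (auto simp: inj_on_def)
  then have "R_vol d A = emeasure (mu d) (zext d ` A)"
    using assms(2) by (simp add: R_vol_def emeasure_mu space_R_vol borel_compact convex_compact_def)
  then show ?thesis using assms(2) by (simp add: emeasure_eq_vol convex_compact_def)
qed

text \<open>
  Images under an injective map commute with intersections, so volumes of intersections can be computed in
  \<open>E d\<close>.
\<close>
lemma R_vol_INT:
  assumes J: "J \<noteq> {}" and body: "\<And>j. j \<in> J \<Longrightarrow> convex_body d (A j)"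
  shows "R_vol d (R_Inter d (A ` J)) = ennreal (vol d (\<Inter>j\<in>J. zext d ` A j))"
proof -
  have R: "A j \<subseteq> R_space d" if "j \<in> J" for j by (rule convex_body_zext(1)[OF body[OF that]])
  obtain j where j: "j \<in> J" using J by auto
  have eq: "R_Inter d (A ` J) = (\<Inter>j\<in>J. A j)" using R j by (auto simp: R_Inter_def)
  have im: "zext d ` (\<Inter>j\<in>J. A j) = (\<Inter>j\<in>J. zext d ` A j)"
    using R j by (intro image_INT[OF inj_on_zext]) auto
  have "convex_compact d (\<Inter>j\<in>J. zext d ` A j)"
    using J convex_body_zext(2)[OF body] by (intro convex_compact_INT) auto
  then show ?thesis
    unfolding eq im[symmetric] using R j by (intro R_vol_zext) auto
qed

lemma R_vol_empty_family:
  assumes "d \<ge> 1" shows "R_vol d (R_Inter d {}) = \<infinity>"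
  using emeasure_E_infinite[OF assms] emeasure_mu[of UNIV d]
  by (simp add: R_vol_def R_Inter_def space_R_vol)

lemma shrink_factor_admissible:
  assumes "d \<ge> (1::nat)"
  shows "2 * d * (4 * d) ^ d * (d\<^sup>2 + d) ^ d < 32 ^ d * d ^ (3 * d)"
proof -
  have "2 * d < 2 * 2 ^ d" by (simp add: less_exp)
  also have "(2::nat) * 2 ^ d \<le> 2 ^ d * 2 ^ d"
    using assms power_increasing[of 1 d "2::nat"] by (intro mult_right_mono) auto
  also have "\<dots> = (4::nat) ^ d" by (simp flip: power_mult_distrib)
  finally have 1: "2 * d < 4 ^ d" .
  have "(d\<^sup>2 + d) ^ d \<le> (2 * d\<^sup>2) ^ d" using assms by (intro power_mono) (auto simp: power2_eq_square)
  then have "2 * d * (4 * d) ^ d * (d\<^sup>2 + d) ^ d \<le> 2 * d * ((4 * d) ^ d * (2 * d\<^sup>2) ^ d)"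
    by (simp add: mult.assoc)
  also have "(4 * d) ^ d * (2 * d\<^sup>2) ^ d = (8 * d ^ 3) ^ d"
  proof -
    have "(4 * d) * (2 * d\<^sup>2) = 8 * d ^ 3" by (simp add: power2_eq_square power3_eq_cube)
    then show ?thesis by (simp only: power_mult_distrib[symmetric])
  qed
  also have "2 * d * (8 * d ^ 3) ^ d < 4 ^ d * (8 * d ^ 3) ^ d"
    using 1 assms by (intro mult_strict_right_mono) auto
  also have "\<dots> = (4 * 8 * d ^ 3) ^ d" by (simp only: power_mult_distrib mult.assoc)
  also have "\<dots> = 32 ^ d * d ^ (3 * d)" by (simp add: power_mult_distrib power_mult)
  finally show ?thesis .
qed

text \<open>
  The left side has the exponent \<open>7 / 2\<close> of \<open>d\<close> where the argument yields \<open>3\<close>; the factor \<open>d\<close> beside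
  \<open>m = 32 ^ d * d ^ (3 * d)\<close> is absorbed in the constant.
\<close>
lemma volume_bound:
  assumes d: "d \<ge> (1::nat)"
  shows "(1 / 64) ^ (d ^ 2) * real d powr (- (7 * real d ^ 2 / 2))
    \<le> (1 / (real (32 ^ d * d ^ (3 * d)) * real d)) ^ d"
proof -
  have d0: "real d \<ge> 1" using d by simp
  have "real d \<le> 2 ^ d" by (metis less_exp less_imp_le of_nat_le_iff of_nat_numeral of_nat_power)
  then have "real (32 ^ d * d ^ (3 * d)) * real d \<le> (32 ^ d * real d ^ (3 * d)) * 2 ^ d"
    by (simp add: mult_left_mono)
  also have "\<dots> = (64 * real d ^ 3) ^ d"
  proof -
    have "(32::real) ^ d * 2 ^ d = 64 ^ d" by (simp flip: power_mult_distrib)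
    then show ?thesis by (simp add: power_mult_distrib power_mult)
  qed
  finally have le: "real (32 ^ d * d ^ (3 * d)) * real d \<le> (64 * real d ^ 3) ^ d" .
  have "(1 / 64) ^ (d ^ 2) * real d powr (- (7 * real d ^ 2 / 2))
      \<le> (1 / 64) ^ (d ^ 2) * real d powr (- (3 * real d ^ 2))"
    using d0 by (intro mult_left_mono powr_mono) auto
  also have "real d powr (- (3 * real d ^ 2)) = 1 / real d ^ (3 * d ^ 2)"
  proof -
    have "real d powr (3 * real d ^ 2) = real d ^ (3 * d ^ 2)"
      using powr_realpow[of "real d" "3 * d ^ 2"] d0 by simp
    then show ?thesis by (simp add: powr_minus_divide)
  qed
  also have "(1 / 64) ^ (d ^ 2) * (1 / real d ^ (3 * d ^ 2)) = (1 / (64 * real d ^ 3) ^ d) ^ d"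
  proof -
    have "((64 * real d ^ 3) ^ d) ^ d = (64 * real d ^ 3) ^ (d ^ 2)"
      by (simp only: power_mult[symmetric] power2_eq_square)
    also have "\<dots> = 64 ^ (d ^ 2) * real d ^ (3 * d ^ 2)"
      by (simp only: power_mult_distrib power_mult[symmetric])
    finally show ?thesis by (simp add: power_one_over)
  qed
  also have "\<dots> \<le> (1 / (real (32 ^ d * d ^ (3 * d)) * real d)) ^ d"
    using le d0 d by (intro power_mono divide_left_mono) auto
  finally show ?thesis .
qed

theorem corollary1p2:
  "\<exists>c::real. c > 0 \<and>
     (\<forall>d::nat. d \<ge> 1 \<longrightarrow>
       (\<forall>\<C> :: nat \<Rightarrow> (nat \<Rightarrow> real) set set.
          (\<forall>i\<in>{1..3*d}. finite (\<C> i) \<and> (\<forall>K\<in>\<C> i. convex_body d K)) \<longrightarrow>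
          (\<forall>(idx :: nat \<Rightarrow> nat) (S :: nat \<Rightarrow> (nat \<Rightarrow> real) set).
             strict_mono_on {1..2*d} idx \<longrightarrow>
             (\<forall>k\<in>{1..2*d}. idx k \<in> {1..3*d} \<and> S k \<in> \<C> (idx k)) \<longrightarrow>
             R_vol d (R_Inter d (S ` {1..2*d})) \<ge> 1) \<longrightarrow>
          (\<exists>i\<in>{1..3*d}.
             R_vol d (R_Inter d (\<C> i)) \<ge> ennreal (c ^ (d ^ 2) * real d powr (- (7 * real d ^ 2 / 2))))))"
proof (intro exI[of _ "1 / 64"] conjI allI impI)
  show "(1 / 64 :: real) > 0" by simp
  fix d :: nat and \<C> :: "nat \<Rightarrow> (nat \<Rightarrow> real) set set"
  assume d: "d \<ge> 1" and bodies: "\<forall>i\<in>{1..3*d}. finite (\<C> i) \<and> (\<forall>K\<in>\<C> i. convex_body d K)"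
    and large: "\<forall>(idx :: nat \<Rightarrow> nat) (S :: nat \<Rightarrow> (nat \<Rightarrow> real) set).
             strict_mono_on {1..2*d} idx \<longrightarrow>
             (\<forall>k\<in>{1..2*d}. idx k \<in> {1..3*d} \<and> S k \<in> \<C> (idx k)) \<longrightarrow>
             R_vol d (R_Inter d (S ` {1..2*d})) \<ge> 1"
  show "\<exists>i\<in>{1..3*d}.
             R_vol d (R_Inter d (\<C> i)) \<ge> ennreal ((1 / 64) ^ (d ^ 2) * real d powr (- (7 * real d ^ 2 / 2)))"
  \<comment> \<open>An empty family has the whole space as its intersection.\<close>
  proof (cases "\<exists>i\<in>{1..3*d}. \<C> i = {}")
    case True
    then obtain i where "i \<in> {1..3*d}" "\<C> i = {}" by blast
    then show ?thesis using R_vol_empty_family[OF d] by (intro bexI[of _ i]) auto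
  next
    case False
    define \<F> where "\<F> i = (\<lambda>K. zext d ` K) ` \<C> i" for i
    define m where "m = 32 ^ d * d ^ (3 * d)"
    have "\<exists>i\<in>{1..3*d}. (1 / (m * d)) ^ d \<le> vol d (\<Inter>(\<F> i))"
    proof (rule colorful_volume[OF d])
      show "finite {1..3*d}" "card {1..3*d} = 3 * d" by auto
      show "finite (\<F> i) \<and> \<F> i \<noteq> {}" if "i \<in> {1..3*d}" for i
        using bodies False that by (auto simp: \<F>_def)
      show "convex_compact d C" if "i \<in> {1..3*d}" "C \<in> \<F> i" for i C
        using bodies that convex_body_zext(2) by (auto simp: \<F>_def)
      show "2 * d * (4 * d) ^ d * (d\<^sup>2 + d) ^ d < m"
        unfolding m_def by (rule shrink_factor_admissible[OF d])
      fix I f assume I: "I \<subseteq> {1..3*d}" "card I = 2 * d" and f: "\<And>i. i \<in> I \<Longrightarrow> f i \<in> \<F> i"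
      have "\<forall>i\<in>I. \<exists>K. K \<in> \<C> i \<and> f i = zext d ` K" using f unfolding \<F>_def by blast
      then obtain K where K: "\<forall>i\<in>I. K i \<in> \<C> i \<and> f i = zext d ` K i" by (rule bchoice[elim_format]) blast
      have finI: "finite I" using I finite_subset by auto
      obtain h where h: "bij_betw h {..<card I} I" "strict_mono_on {..<card I} h"
        using ex_bij_betw_strict_mono_card[OF finI] by blast
      \<comment> \<open>The increasing enumeration of \<open>I\<close> starts at \<open>0\<close>, the selections start at \<open>1\<close>.\<close>
      define idx where "idx k = h (k - 1)" for k
      have im: "idx ` {1..2*d} = I"
      proof -
        have "(\<lambda>k. k - 1) ` {1..2*d} = {..<2*d}"
          by (auto simp: image_iff intro!: bexI[of _ "Suc _"])
        then have "idx ` {1..2*d} = h ` {..<2*d}" unfolding idx_def by (metis image_image)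
        then show ?thesis using h I by (simp add: bij_betw_def)
      qed
      have "strict_mono_on {1..2*d} idx"
      proof (rule strict_mono_onI)
        fix r s assume rs: "r \<in> {1..2*d}" "s \<in> {1..2*d}" "r < s"
        then have "r - 1 \<in> {..<card I}" "s - 1 \<in> {..<card I}" "r - 1 < s - 1" using I by auto
        then show "idx r < idx s" using h(2) by (simp add: idx_def strict_mono_on_def)
      qed
      moreover have "\<forall>k\<in>{1..2*d}. idx k \<in> {1..3*d} \<and> K (idx k) \<in> \<C> (idx k)"
        using im I K by blast
      ultimately have "1 \<le> R_vol d (R_Inter d ((\<lambda>k. K (idx k)) ` {1..2*d}))"
        by (rule large[THEN spec[of _ idx], THEN spec[of _ "\<lambda>k. K (idx k)"], THEN mp, THEN mp])
      also have "(\<lambda>k. K (idx k)) ` {1..2*d} = K ` I" unfolding im[symmetric] by (simp add: image_image)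
      also have "R_vol d (R_Inter d (K ` I)) = ennreal (vol d (\<Inter>i\<in>I. zext d ` K i))"
        using I d K bodies by (intro R_vol_INT) auto
      also have "(\<Inter>i\<in>I. zext d ` K i) = (\<Inter>i\<in>I. f i)" using K by auto
      finally show "1 \<le> vol d (\<Inter>i\<in>I. f i)" by simp
    qed
    then obtain i where i: "i \<in> {1..3*d}" and "(1 / (m * d)) ^ d \<le> vol d (\<Inter>(\<F> i))"
      by (rule bexE)
    then have le: "(1 / (real m * real d)) ^ d \<le> vol d (\<Inter>(\<F> i))" by simp
    have "R_vol d (R_Inter d (\<C> i)) = ennreal (vol d (\<Inter>(\<F> i)))"
      using R_vol_INT[of "\<C> i" d id] bodies False i by (auto simp: \<F>_def)
    moreover have "(1 / 64) ^ (d ^ 2) * real d powr (- (7 * real d ^ 2 / 2)) \<le> vol d (\<Inter>(\<F> i))"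
      using volume_bound[OF d] le unfolding m_def by (rule order_trans)
    ultimately show ?thesis using i by (intro bexI[of _ i]) (auto intro: ennreal_leI)
  qed
qed

end
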